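(* Let $(\Gamma,\alpha)$ be an abstract one-skeleton with axial function $\alpha:E_\Gamma\to\mathfrak g^*$, let $\xi\in\mathfrak g$ be a generic and polarizing vector such that $(\Gamma,\alpha)$ is $\xi$-acyclic, and let $\phi:V\to\mathbb R$ be an injective $\xi$-compatible Morse function. Then $(\Gamma,\alpha)$ admits a generating family if and only if, for every two-dimensional subspace $\mathfrak h^*\subset\mathfrak g^*$, every connected component of the induced one-skeleton $(\Gamma_{\mathfrak h^*},\alpha)$ admits a generating family.
   Context: $\Gamma$ is a finite $d$-valent graph with vertex set $V$ and set of oriented edges $E_\Gamma$. For $e\in E_\Gamma$, $\bar e$ is $e$ with reversed orientation, $i(e)$ and $t(e)$ are its initial and terminal vertices; $E_p=\{e: i(e)=p\}$, which has exactly $d$ elements for each $p\in V$. $\mathfrak g^*$ is a real vector space of dimension $n>1$ with dual $\mathfrak g$; $\mathbb S(\mathfrak g^* )=\bigoplus_k\mathbb S^k(\mathfrak g^* )$ is its symmetric algebra (polynomial functions on $\mathfrak g$). Abstract one-skeleton: a pair $(\Gamma,\alpha)$ with $\alpha:E_\Gamma\to\mathfrak g^*$, $e\mapsto\alpha_e$ (the axial function), such that: (A1) for every $p\in V$ the vectors $\alpha_e$, $e\in E_p$, are pairwise linearly independent; (A2) $\alpha_{\bar e}=-\alpha_e$; (A3) for every $e\in E_\Gamma$ with $p=i(e)$, $p'=t(e)$, one can order $E_p=\{e_1,\dots,e_d\}$ and $E_{p'}=\{e_1',\dots,e_d'\}$ so that $e_d=e$, $e_d'=\bar e$ and $\alpha_{e_i'}=\alpha_{e_i}+c_{i,e}\alpha_e$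 with $c_{i,e}\in\mathbb R$. $\xi\in\mathfrak g$ is polarizing if $\alpha_e(\xi)\ne0$ for all $e\in E_\Gamma$. It is generic if for every $p\in V$ and edges $e_1,e_2,e_3,e_4\in E_p$ with $e_1\ne e_2$, $e_3\ne e_4$, $(e_1,e_2)\neq(e_3,e_4)$, one has $\frac{\alpha_{e_1}}{\alpha_{e_1}(\xi)}-\frac{\alpha_{e_2}}{\alpha_{e_2}(\xi)}\ne\frac{\alpha_{e_3}}{\alpha_{e_3}(\xi)}-\frac{\alpha_{e_4}}{\alpha_{e_4}(\xi)}$. The orientation $o_\xi$ orients each edge so that $\alpha_e(\xi)>0$; $(\Gamma,\alpha)$ is $\xi$-acyclic if $o_\xi$ has no oriented cycles. $\phi:V\to\mathbb R$ is $\xi$-compatible (a Morse function) if $\phi(i(e))<\phi(t(e))$ whenever $\alpha_e(\xi)>0$. $H(\Gamma,\alpha)$ is the set of maps $f:V\to\mathbb S(\mathfrak g^* )$ with $f_{i(e)}\equiv f_{t(e)}\pmod{\alpha_e}$ for every $e\in E_\Gamma$. The flow-up $F_p$ of $p\in V$ is the set of vertices (including $p$) that can be reached from $p$ by a path of edges oriented by $o_\xi$ (equivalently, along which $\phi$ is strictly increasing). A generating class at $p$ is an element $\tau^{(p)}\in H(\Gamma,\alpha)$ that vanishes outside $F_p$ and satisfies $\tau^{(p)}(p)=\prod\alpha_e$, the product being over $e\in E_p$ with $\alpha_e(\xi)<0$. A generating family is a collection $\{\tau^{(p)}\}_{p\in V}$ with one generating class for each vertex. For a linear subspace $\mathfrak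 h^*\subset\mathfrak g^*$, $\Gamma_{\mathfrak h^*}$ is the subgraph of $\Gamma$ whose edges are all $e$ with $\alpha_e\in\mathfrak h^*$. Each of its connected components is a regular graph which, with the restriction of $\alpha$, is an abstract one-skeleton with axial function valued in $\mathfrak h^*$. Generating classes and families for such a component are defined in the same way, using the same $\xi$ and $\phi$, with the component's own vertices, edges and flow-ups, and with cohomology ring consisting of $\mathbb S(\mathfrak h^* )$-valued maps on its vertices. *)

theory Defs
  imports "HOL-Analysis.Analysis" "Graph_Theory.Graph_Theory"
begin

text \<open>
  The type \<open>'g\<close> plays the role of the Lie algebra; its inner product is never used.  Its dual is
  the type \<open>'g \<Rightarrow>\<^sub>L real\<close> of linear functionals.  A graph is a digraph whose arcs are
  the oriented edges; \<open>tail\<close>, \<open>head\<close> and \<open>bar\<close> are the initial vertex, the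
  terminal vertex and orientation reversal, and \<open>out_arcs \<Gamma> p\<close> is the set of edges
  issuing from \<open>p\<close>.  Multiple edges are allowed.
\<close>

text \<open>
  The locale \<^locale>\<open>bidirected_digraph\<close> makes \<open>bar\<close> a fixed-point free involution of the
  arcs that exchanges head and tail, and (by convention) the identity outside the arcs.
\<close>

locale one_skeleton =
  fin_digraph \<Gamma> + bidirected_digraph \<Gamma> bar
  for \<Gamma> :: "('v, 'e) pre_digraph" and bar :: "'e \<Rightarrow> 'e" +
  fixes d :: nat
    and \<alpha> :: "'e \<Rightarrow> ('g::euclidean_space \<Rightarrow>\<^sub>L real)"
  assumes valence: "p \<in> verts \<Gamma> \<Longrightarrow> out_degree \<Gamma> p = d"
    and axial_independent:
      "\<lbrakk>p \<in> verts \<Gamma>; e \<in> out_arcs \<Gamma> p; e' \<in> out_arcs \<Gamma> p; e \<noteq> e'\<rbrakk>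
        \<Longrightarrow> \<alpha> e \<noteq> \<alpha> e' \<and> independent {\<alpha> e, \<alpha> e'}"
    and axial_bar: "e \<in> arcs \<Gamma> \<Longrightarrow> \<alpha> (bar e) = - \<alpha> e"
    and axial_transport:
      "e \<in> arcs \<Gamma> \<Longrightarrow>
        \<exists>es es' :: nat \<Rightarrow> 'e. \<exists>c :: nat \<Rightarrow> real.
          bij_betw es {1..d} (out_arcs \<Gamma> (tail \<Gamma> e)) \<and>
          bij_betw es' {1..d} (out_arcs \<Gamma> (head \<Gamma> e)) \<and>
          es d = e \<and> es' d = bar e \<and>
          (\<forall>i\<in>{1..d}. \<alpha> (es' i) = \<alpha> (es i) + c i *\<^sub>R \<alpha> e)"

definition polarizing ::
    "('v, 'e) pre_digraph \<Rightarrow> ('e \<Rightarrow> ('g::euclidean_space \<Rightarrow>\<^sub>L real)) \<Rightarrow> 'g \<Rightarrow> bool" where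
  "polarizing \<Gamma> \<alpha> \<xi> \<longleftrightarrow> (\<forall>e\<in>arcs \<Gamma>. \<alpha> e \<xi> \<noteq> 0)"

definition generic ::
    "('v, 'e) pre_digraph \<Rightarrow> ('e \<Rightarrow> ('g::euclidean_space \<Rightarrow>\<^sub>L real)) \<Rightarrow> 'g \<Rightarrow> bool" where
  "generic \<Gamma> \<alpha> \<xi> \<longleftrightarrow>
    (\<forall>p\<in>verts \<Gamma>. \<forall>e1\<in>out_arcs \<Gamma> p. \<forall>e2\<in>out_arcs \<Gamma> p. \<forall>e3\<in>out_arcs \<Gamma> p. \<forall>e4\<in>out_arcs \<Gamma> p.
      e1 \<noteq> e2 \<longrightarrow> e3 \<noteq> e4 \<longrightarrow> (e1, e2) \<noteq> (e3, e4) \<longrightarrow>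
      \<alpha> e1 /\<^sub>R \<alpha> e1 \<xi> - \<alpha> e2 /\<^sub>R \<alpha> e2 \<xi> \<noteq> \<alpha> e3 /\<^sub>R \<alpha> e3 \<xi> - \<alpha> e4 /\<^sub>R \<alpha> e4 \<xi>)"

definition orient ::
    "('v, 'e) pre_digraph \<Rightarrow> ('e \<Rightarrow> ('g::euclidean_space \<Rightarrow>\<^sub>L real)) \<Rightarrow> 'g \<Rightarrow> ('v, 'e) pre_digraph" where
  "orient \<Gamma> \<alpha> \<xi> = \<Gamma>\<lparr>arcs := {e \<in> arcs \<Gamma>. \<alpha> e \<xi> > 0}\<rparr>"

definition xi_acyclic ::
    "('v, 'e) pre_digraph \<Rightarrow> ('e \<Rightarrow> ('g::euclidean_space \<Rightarrow>\<^sub>L real)) \<Rightarrow> 'g \<Rightarrow> bool" where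
  "xi_acyclic \<Gamma> \<alpha> \<xi> \<longleftrightarrow> \<not> (\<exists>c. pre_digraph.cycle (orient \<Gamma> \<alpha> \<xi>) c)"

definition xi_compatible ::
    "('v, 'e) pre_digraph \<Rightarrow> ('e \<Rightarrow> ('g::euclidean_space \<Rightarrow>\<^sub>L real)) \<Rightarrow> 'g \<Rightarrow> ('v \<Rightarrow> real) \<Rightarrow> bool" where
  "xi_compatible \<Gamma> \<alpha> \<xi> \<phi> \<longleftrightarrow>
    (\<forall>e\<in>arcs \<Gamma>. \<alpha> e \<xi> > 0 \<longrightarrow> \<phi> (tail \<Gamma> e) < \<phi> (head \<Gamma> e))"

text \<open>
  The symmetric algebra of a subspace \<open>H\<close> of the dual, realised inside the polynomial functions
  on \<open>'g\<close> as the subalgebra generated by \<open>H\<close>.  For \<open>H = UNIV\<close> these are all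
  polynomial functions.
\<close>

inductive_set sym_alg :: "('g::euclidean_space \<Rightarrow>\<^sub>L real) set \<Rightarrow> ('g \<Rightarrow> real) set"
  for H :: "('g \<Rightarrow>\<^sub>L real) set" where
  linear: "a \<in> H \<Longrightarrow> (\<lambda>x. a x) \<in> sym_alg H"
| const: "(\<lambda>x. c) \<in> sym_alg H"
| add: "\<lbrakk>f \<in> sym_alg H; g \<in> sym_alg H\<rbrakk> \<Longrightarrow> (\<lambda>x. f x + g x) \<in> sym_alg H"
| mult: "\<lbrakk>f \<in> sym_alg H; g \<in> sym_alg H\<rbrakk> \<Longrightarrow> (\<lambda>x. f x * g x) \<in> sym_alg H"

lemma sym_alg_UNIV: "sym_alg UNIV = {f. real_polynomial_function f}"
proof (intro set_eqI iffI; unfold mem_Collect_eq)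
  fix f :: "'a \<Rightarrow> real"
  show "real_polynomial_function f" if "f \<in> sym_alg UNIV"
    using that by induction (auto intro: blinfun.bounded_linear_right)
  show "f \<in> sym_alg UNIV" if "real_polynomial_function f"
    using that
  proof induction
    case (linear f)
    then show ?case
      using sym_alg.linear[of "Blinfun f" UNIV] by (simp add: bounded_linear_Blinfun_apply)
  qed (auto intro: sym_alg.intros)
qed

text \<open>
  In the following definitions the graph is to be thought of as carrying an axial function with
  values in the subspace \<open>H\<close>, and the coefficient ring is \<open>sym_alg H\<close>.
\<close>

definition cohomology ::
    "('v, 'e) pre_digraph \<Rightarrow> ('e \<Rightarrow> ('g::euclidean_space \<Rightarrow>\<^sub>L real)) \<Rightarrow> ('g \<Rightarrow>\<^sub>L real) set
      \<Rightarrow> ('v \<Rightarrow> 'g \<Rightarrow> real) set" where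
  "cohomology \<Gamma> \<alpha> H =
    {f. (\<forall>p\<in>verts \<Gamma>. f p \<in> sym_alg H) \<and>
        (\<forall>e\<in>arcs \<Gamma>. \<exists>q\<in>sym_alg H. \<forall>x. f (tail \<Gamma> e) x - f (head \<Gamma> e) x = \<alpha> e x * q x)}"

definition flow_up ::
    "('v, 'e) pre_digraph \<Rightarrow> ('e \<Rightarrow> ('g::euclidean_space \<Rightarrow>\<^sub>L real)) \<Rightarrow> 'g \<Rightarrow> 'v \<Rightarrow> 'v set" where
  "flow_up \<Gamma> \<alpha> \<xi> p = {q. p \<rightarrow>\<^sup>*\<^bsub>orient \<Gamma> \<alpha> \<xi>\<^esub> q}"

definition generating_class ::
    "('v, 'e) pre_digraph \<Rightarrow> ('e \<Rightarrow> ('g::euclidean_space \<Rightarrow>\<^sub>L real)) \<Rightarrow> ('g \<Rightarrow>\<^sub>L real) set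
      \<Rightarrow> 'g \<Rightarrow> 'v \<Rightarrow> ('v \<Rightarrow> 'g \<Rightarrow> real) \<Rightarrow> bool" where
  "generating_class \<Gamma> \<alpha> H \<xi> p \<tau> \<longleftrightarrow>
    \<tau> \<in> cohomology \<Gamma> \<alpha> H \<and>
    (\<forall>q \<in> verts \<Gamma> - flow_up \<Gamma> \<alpha> \<xi> p. \<tau> q = (\<lambda>x. 0)) \<and>
    \<tau> p = (\<lambda>x. \<Prod>e \<in> {e \<in> out_arcs \<Gamma> p. \<alpha> e \<xi> < 0}. \<alpha> e x)"

definition admits_generating_family ::
    "('v, 'e) pre_digraph \<Rightarrow> ('e \<Rightarrow> ('g::euclidean_space \<Rightarrow>\<^sub>L real)) \<Rightarrow> ('g \<Rightarrow>\<^sub>L real) set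
      \<Rightarrow> 'g \<Rightarrow> bool" where
  "admits_generating_family \<Gamma> \<alpha> H \<xi> \<longleftrightarrow>
    (\<exists>\<tau>. \<forall>p\<in>verts \<Gamma>. generating_class \<Gamma> \<alpha> H \<xi> p (\<tau> p))"

text \<open>
  All vertices are kept; a vertex with no edge in direction \<open>H\<close> is a component of valence 0,
  for which the constant 1 is a generating family.
\<close>

definition restrict_skeleton ::
    "('v, 'e) pre_digraph \<Rightarrow> ('e \<Rightarrow> ('g::euclidean_space \<Rightarrow>\<^sub>L real)) \<Rightarrow> ('g \<Rightarrow>\<^sub>L real) set
      \<Rightarrow> ('v, 'e) pre_digraph" where
  "restrict_skeleton \<Gamma> \<alpha> H = \<Gamma>\<lparr>arcs := {e \<in> arcs \<Gamma>. \<alpha> e \<in> H}\<rparr>"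

definition component_of :: "('v, 'e) pre_digraph \<Rightarrow> ('v, 'e) pre_digraph \<Rightarrow> bool" where
  "component_of C \<Gamma> \<longleftrightarrow> pre_digraph.max_subgraph \<Gamma> Digraph_Component.connected C"

end

theory Submission
  imports Defs
begin

text \<open>
  A congruence modulo \<open>\<alpha>\<^sub>e\<close> is equality on the kernel of \<open>\<alpha>\<^sub>e\<close>.  A
  generating family exists if and only if every partial class, defined on the vertices below some
  vertex \<open>v\<close>, extends to \<open>v\<close>: given the family, subtracting multiples of its members from the
  bottom up writes a partial class as a combination of them; conversely, one builds each generating
  class vertex by vertex.

  Extending to \<open>v\<close> means interpolating prescribed polynomials on the kernels of the descending edges
  at \<open>v\<close>.  Interpolation on hyperplanes is a condition in codimension two, i.e. it is solvable as
  soon as it is solvable for the hyperplanes whose equations lie in any given plane, and for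
  each plane the partial class extends because the component of \<open>v\<close> has a generating family.

  Conversely, a generating class of \<open>\<Gamma>\<close> at \<open>p\<close>, restricted to a component with axial functions in
  \<open>H\<close> and to a generic translate of a complement of the annihilator of \<open>H\<close>, takes at \<open>p\<close> the required
  product times a polynomial that does not vanish at \<open>0\<close>; its homogeneous part of the degree of that
  product is, up to a constant, a class of the component with the right value at \<open>p\<close>.
\<close>

section \<open>Divisibility of polynomial functions by products of linear functionals\<close>

lemma sym_alg_mono: "H \<subseteq> H' \<Longrightarrow> f \<in> sym_alg H \<Longrightarrow> f \<in> sym_alg H'"
  by (erule sym_alg.induct) (auto intro: sym_alg.intros)

lemma sym_alg_diff:
  assumes "f \<in> sym_alg H" "g \<in> sym_alg H"
  shows "(\<lambda>x. f x - g x) \<in> sym_alg H"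
  using sym_alg.add[OF assms(1) sym_alg.mult[OF sym_alg.const[of "-1"] assms(2)]] by simp

lemma sym_alg_sum:
  "(\<And>i. i \<in> I \<Longrightarrow> f i \<in> sym_alg H) \<Longrightarrow> (\<lambda>x. \<Sum>i\<in>I. f i x) \<in> sym_alg H"
  by (induction I rule: infinite_finite_induct) (auto intro: sym_alg.intros)

lemma sym_alg_prod:
  "(\<And>i. i \<in> I \<Longrightarrow> f i \<in> sym_alg H) \<Longrightarrow> (\<lambda>x. \<Prod>i\<in>I. f i x) \<in> sym_alg H"
  by (induction I rule: infinite_finite_induct) (auto intro: sym_alg.intros)

lemma continuous_on_sym_alg: "f \<in> sym_alg H \<Longrightarrow> continuous_on S f"
  by (induction rule: sym_alg.induct) (auto intro!: continuous_intros)

text \<open>Only generators need checking. Pullbacks may acquire constants because translations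
  occur among the substitutions.\<close>

lemma sym_alg_compose_affine:
  assumes "f \<in> sym_alg H"
    and "\<And>b. b \<in> H \<Longrightarrow> \<exists>b' \<in> H'. \<exists>c. \<forall>x. blinfun_apply b (h x) = blinfun_apply b' x + c"
  shows "(\<lambda>x. f (h x)) \<in> sym_alg H'"
  using assms(1)
proof induction
  case (linear a)
  then obtain b' c where "b' \<in> H'" and b': "\<And>x. a (h x) = b' x + c"
    using assms(2) by metis
  then show ?case
    unfolding b' by (intro sym_alg.intros)
qed (auto intro: sym_alg.intros)

text \<open>On the line through \<open>x\<close> in direction \<open>w\<close>, which stays in
  \<open>K\<close>, the functional \<open>b\<close> has a single zero, so continuity gives equality
  there too. The subspace \<open>K\<close> is kept general because the arguments below pass to
  hyperplanes.\<close>

lemma linear_cancel: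
  fixes b :: "'g::euclidean_space \<Rightarrow>\<^sub>L real"
  assumes K: "subspace K" and w: "w \<in> K" "b w \<noteq> 0"
    and F: "continuous_on UNIV F" and G: "continuous_on UNIV G"
    and eq: "\<And>x. x \<in> K \<Longrightarrow> b x * F x = b x * (G x :: real)"
    and x: "x \<in> K"
  shows "F x = G x"
proof (cases "b x = 0")
  case True
  define D where "D t = F (x + t *\<^sub>R w) - G (x + t *\<^sub>R w)" for t
  have "D t = 0" if "t \<noteq> 0" for t
  proof -
    have "x + t *\<^sub>R w \<in> K"
      using K w x by (simp add: subspace_add subspace_scale)
    from eq[OF this] show ?thesis
      using that True w by (simp add: D_def blinfun.add_right blinfun.scaleR_right)
  qed
  then have "(D \<longlongrightarrow> 0) (at 0)"
    by (intro tendsto_eventually) (auto simp: eventually_at_filter)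
  moreover have "continuous_on UNIV D"
    unfolding D_def
    by (intro continuous_intros continuous_on_compose2[OF F] continuous_on_compose2[OF G]) auto
  then have "(D \<longlongrightarrow> D 0) (at 0)"
    by (simp add: continuous_on_def)
  ultimately have "D 0 = 0"
    using tendsto_unique trivial_limit_at by blast
  then show ?thesis
    by (simp add: D_def)
qed (use eq[OF x] in auto)

text \<open>Cancel the factors one at a time: none of them is a zero divisor among continuous
  functions on \<open>K\<close>.\<close>

lemma prod_linear_cancel:
  fixes b :: "'i \<Rightarrow> 'g::euclidean_space \<Rightarrow>\<^sub>L real"
  assumes K: "subspace K" and nz: "\<And>i. i \<in> A \<Longrightarrow> \<exists>w\<in>K. b i w \<noteq> 0"
    and v: "continuous_on UNIV v"
    and eq: "\<And>x. x \<in> K \<Longrightarrow> (\<Prod>i\<in>A. b i x) * v x = 0"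
    and x: "x \<in> K"
  shows "v x = 0"
proof -
  have "\<forall>x\<in>K. v x = 0"
    using nz eq
  proof (induction A rule: infinite_finite_induct)
    case (insert i A)
    then obtain w where w: "w \<in> K" "b i w \<noteq> 0"
      by blast
    have "(\<Prod>i\<in>A. b i x) * v x = 0" if "x \<in> K" for x
    proof (rule linear_cancel[OF K w, where F = "\<lambda>x. (\<Prod>i\<in>A. b i x) * v x" and G = "\<lambda>x. 0"])
      show "b i x * ((\<Prod>i\<in>A. b i x) * v x) = b i x * 0" if "x \<in> K" for x
        using insert.prems(2)[OF that] insert.hyps by simp
    qed (use that in \<open>auto intro!: continuous_intros v\<close>)
    with insert show ?case
      by simp
  qed auto
  with x show ?thesis
    by blast
qed

text \<open>Projection along a vector with \<open>b v = 1\<close> is a map \<open>r\<close> into the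
  kernel of \<open>b\<close> that fixes every generator modulo \<open>b\<close>. Hence
  \<open>f\<close> and its composition with \<open>r\<close> differ by a multiple of
  \<open>b\<close>, and the composition is zero on \<open>K\<close> if \<open>f\<close> vanishes on
  the kernel in \<open>K\<close>.\<close>

lemma linear_dvd_iff_vanishes_on_kernel:
  fixes b :: "'g::euclidean_space \<Rightarrow>\<^sub>L real"
  assumes H: "subspace H" "b \<in> H" and K: "subspace K" and w: "w \<in> K" "b w \<noteq> 0"
    and f: "f \<in> sym_alg H"
  shows "(\<exists>q\<in>sym_alg H. \<forall>x\<in>K. f x = b x * q x) \<longleftrightarrow> (\<forall>x\<in>K. b x = 0 \<longrightarrow> f x = 0)"
proof
  define v where "v = w /\<^sub>R b w"
  have v: "v \<in> K" "b v = 1"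
    using K w by (auto simp: v_def subspace_scale blinfun.scaleR_right)
  define r where "r x = x - b x *\<^sub>R v" for x
  \<comment> \<open>A generator \<open>a\<close> becomes \<open>a - a v *\<^sub>R b\<close>, again
    in \<open>H\<close>; this keeps the quotients in \<open>sym_alg H\<close>.\<close>
  have comp: "(\<lambda>x. g (r x)) \<in> sym_alg H" if "g \<in> sym_alg H" for g
    using that
  proof (rule sym_alg_compose_affine)
    fix a assume "a \<in> H"
    moreover have "a (r x) = (a - a v *\<^sub>R b) x" for x
      by (simp add: r_def blinfun.diff_left blinfun.diff_right blinfun.scaleR_right blinfun.scaleR_left)
    ultimately show "\<exists>b'\<in>H. \<exists>c. \<forall>x. blinfun_apply a (r x) = blinfun_apply b' x + c"
      using H by (intro bexI[of _ "a - a v *\<^sub>R b"] exI[of _ 0]) (auto simp: subspace_diff subspace_scale)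
  qed
  have "\<exists>q\<in>sym_alg H. \<forall>x. f x = f (r x) + b x * q x"
    using f
  proof induction
    case (linear a)
    show ?case
      by (intro bexI[of _ "\<lambda>x. a v"] sym_alg.const)
        (simp add: r_def blinfun.diff_right blinfun.scaleR_right)
  next
    case (const c)
    show ?case
      by (intro bexI[of _ "\<lambda>x. 0"] sym_alg.const) simp
  next
    case (add f g)
    then obtain p q where p: "p \<in> sym_alg H" "\<forall>x. f x = f (r x) + b x * p x"
      and q: "q \<in> sym_alg H" "\<forall>x. g x = g (r x) + b x * q x" by blast
    show ?case
    proof (intro bexI[of _ "\<lambda>x. p x + q x"] allI)
      show "f x + g x = f (r x) + g (r x) + b x * (p x + q x)" for x
        using p(2)[rule_format, of x] q(2)[rule_format, of x] by (simp add: algebra_simps)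
    qed (rule sym_alg.add[OF p(1) q(1)])
  next
    case (mult f g)
    then obtain p q where p: "p \<in> sym_alg H" "\<forall>x. f x = f (r x) + b x * p x"
      and q: "q \<in> sym_alg H" "\<forall>x. g x = g (r x) + b x * q x" by blast
    show ?case
    \<comment> \<open>The quotient comes from the product rule for differences.\<close>
    proof (intro bexI[of _ "\<lambda>x. f x * q x + p x * g (r x)"] allI)
      show "f x * g x = f (r x) * g (r x) + b x * (f x * q x + p x * g (r x))" for x
      proof -
      have "f x * g x - f (r x) * g (r x) = f x * (g x - g (r x)) + (f x - f (r x)) * g (r x)"
        by (simp add: algebra_simps)
      also have "\<dots> = f x * (b x * q x) + (b x * p x) * g (r x)"
        using p(2)[rule_format, of x] q(2)[rule_format, of x] by simp
      finally show ?thesis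
        by (simp add: algebra_simps)
      qed
      show "(\<lambda>x. f x * q x + p x * g (r x)) \<in> sym_alg H"
        by (rule sym_alg.add[OF sym_alg.mult[OF mult.hyps(1) q(1)] sym_alg.mult[OF p(1) comp[OF mult.hyps(2)]]])
    qed
  qed
  then obtain q where q: "q \<in> sym_alg H" "\<And>x. f x = f (r x) + b x * q x"
    by blast
  assume *: "\<forall>x\<in>K. b x = 0 \<longrightarrow> f x = 0"
  have "f (r x) = 0" if "x \<in> K" for x
    using that * v K by (auto simp: r_def subspace_diff subspace_scale blinfun.diff_right blinfun.scaleR_right)
  with q show "\<exists>q\<in>sym_alg H. \<forall>x\<in>K. f x = b x * q x"
    by (metis add_0)
qed auto

text \<open>Remove the factors indexed by \<open>J\<close> one at a time. On the kernel of
  \<open>b j\<close> in \<open>K\<close> the right-hand side is zero and the product over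
  \<open>A\<close> can be cancelled, so \<open>u\<close> vanishes there; thus \<open>b j\<close>
  divides \<open>u\<close> on \<open>K\<close> and drops out of both sides.\<close>

lemma dvd_prod_cancel_coprime:
  fixes b :: "'i \<Rightarrow> 'g::euclidean_space \<Rightarrow>\<^sub>L real"
  assumes H: "subspace H" "\<And>j. j \<in> A \<union> J \<Longrightarrow> b j \<in> H" and K: "subspace K"
    and fin: "finite A" "finite J"
    and nz: "\<And>j. j \<in> J \<Longrightarrow> \<exists>x\<in>K. b j x \<noteq> 0"
    and coprime: "\<And>i j. i \<in> A \<Longrightarrow> j \<in> J \<Longrightarrow> \<exists>x\<in>K. b j x = 0 \<and> b i x \<noteq> 0"
    and "u \<in> sym_alg H" "G \<in> sym_alg H"
    and "\<And>x. x \<in> K \<Longrightarrow> (\<Prod>i\<in>A. b i x) * u x = (\<Prod>j\<in>J. b j x) * G x"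
  shows "\<exists>q\<in>sym_alg H. \<forall>x\<in>K. G x = (\<Prod>i\<in>A. b i x) * q x"
  using \<open>finite J\<close> H(2) nz coprime assms(8-)
proof (induction J arbitrary: u rule: finite_induct)
  case empty
  then show ?case
    by (intro bexI[of _ u]) auto
next
  case (insert j J)
  define L where "L = {x\<in>K. b j x = 0}"
  have L: "subspace L"
    using K unfolding L_def subspace_def by (auto simp: blinfun.add_right blinfun.scaleR_right)
  obtain w where w: "w \<in> K" "b j w \<noteq> 0"
    using insert.prems by blast
  have bj: "b j \<in> H" and PJ: "(\<lambda>x. \<Prod>j\<in>J. b j x) \<in> sym_alg H" and PA: "(\<lambda>x. \<Prod>j\<in>A. b j x) \<in> sym_alg H"
    using insert.prems(1) by (auto intro!: sym_alg_prod sym_alg.linear)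
  have "u x = 0" if "x \<in> L" for x
  proof (rule prod_linear_cancel[OF L, of A b])
    show "\<exists>w\<in>L. b i w \<noteq> 0" if "i \<in> A" for i
      using that insert.prems(3)[of i j] by (auto simp: L_def)
    show "(\<Prod>i\<in>A. b i x) * u x = 0" if "x \<in> L" for x
      using that insert.prems(6)[of x] insert.hyps by (auto simp: L_def)
  qed (use that insert.prems(4) continuous_on_sym_alg in auto)
  then obtain u' where u': "u' \<in> sym_alg H" "\<And>x. x \<in> K \<Longrightarrow> u x = b j x * u' x"
    using linear_dvd_iff_vanishes_on_kernel[OF H(1) bj K w \<open>u \<in> sym_alg H\<close>]
    by (auto simp: L_def)
  have "(\<Prod>i\<in>A. b i x) * u' x = (\<Prod>j\<in>J. b j x) * G x" if "x \<in> K" for x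
  proof (rule linear_cancel[OF K w, where F="\<lambda>x. (\<Prod>i\<in>A. b i x) * u' x"])
    fix x assume "x \<in> K"
    then show "b j x * ((\<Prod>i\<in>A. b i x) * u' x) = b j x * ((\<Prod>j\<in>J. b j x) * G x)"
      using insert.prems(6)[of x] u'(2)[of x] insert.hyps by (simp add: mult_ac)
  qed (use that u' PA PJ insert.prems in \<open>auto intro!: continuous_on_sym_alg sym_alg.mult\<close>)
  with insert u'(1) show ?case
    by (intro insert.IH[of u']) auto
qed

text \<open>Distinct functionals may become proportional on \<open>K\<close>, and then vanishing on
  their kernels does not account for multiplicity. Divisibility is therefore assumed for whole
  classes, coprime to each other on \<open>K\<close>, and the classes are joined one by one.\<close>

lemma prod_dvd_if_classes_dvd:
  fixes b :: "'i \<Rightarrow> 'g::euclidean_space \<Rightarrow>\<^sub>L real" and \<kappa> :: "'i \<Rightarrow> 'k"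
  assumes H: "subspace H" "\<And>j. j \<in> J \<Longrightarrow> b j \<in> H" and K: "subspace K"
    and fin: "finite J"
    and nz: "\<And>j. j \<in> J \<Longrightarrow> \<exists>x\<in>K. b j x \<noteq> 0"
    and coprime: "\<And>i j. i \<in> J \<Longrightarrow> j \<in> J \<Longrightarrow> \<kappa> i \<noteq> \<kappa> j \<Longrightarrow> \<exists>x\<in>K. b j x = 0 \<and> b i x \<noteq> 0"
    and F: "F \<in> sym_alg H"
    and dvd: "\<And>i. i \<in> J \<Longrightarrow> \<exists>q\<in>sym_alg H. \<forall>x\<in>K. F x = (\<Prod>j\<in>{j\<in>J. \<kappa> j = \<kappa> i}. b j x) * q x"
  shows "\<exists>q\<in>sym_alg H. \<forall>x\<in>K. F x = (\<Prod>j\<in>J. b j x) * q x"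
proof -
  have "\<exists>q\<in>sym_alg H. \<forall>x\<in>K. F x = (\<Prod>j\<in>{j\<in>J. \<kappa> j \<in> T}. b j x) * q x" if "T \<subseteq> \<kappa> ` J" for T
    using finite_subset[OF that finite_imageI[OF fin]] that
  proof (induction T rule: finite_induct)
    case (insert t T)
    define B where "B = {j\<in>J. \<kappa> j \<in> T}"
    define A where "A = {j\<in>J. \<kappa> j = t}"
    obtain G where G: "G \<in> sym_alg H" "\<And>x. x \<in> K \<Longrightarrow> F x = (\<Prod>j\<in>B. b j x) * G x"
      using insert unfolding B_def by auto
    obtain i where "i \<in> J" "\<kappa> i = t"
      using insert.prems by auto
    with dvd[of i] obtain u where
      u: "u \<in> sym_alg H" "\<And>x. x \<in> K \<Longrightarrow> F x = (\<Prod>j\<in>A. b j x) * u x"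
      unfolding A_def by auto
    \<comment> \<open>Two factorizations of \<open>F\<close> are available on \<open>K\<close>, one
      through \<open>B\<close> and one through \<open>A\<close>, with coprime factors.\<close>
    have "\<exists>q\<in>sym_alg H. \<forall>x\<in>K. G x = (\<Prod>i\<in>A. b i x) * q x"
    proof (rule dvd_prod_cancel_coprime[where J = B and u = u and H = H, OF H(1) _ K])
      show "\<exists>x\<in>K. b j x = 0 \<and> b i x \<noteq> 0" if "i \<in> A" "j \<in> B" for i j
        using that insert.hyps by (intro coprime) (auto simp: A_def B_def)
    qed (use H fin nz G u in \<open>auto simp: A_def B_def\<close>)
    then obtain q where q: "q \<in> sym_alg H" "\<And>x. x \<in> K \<Longrightarrow> G x = (\<Prod>i\<in>A. b i x) * q x"
      by blast
    have split: "{j\<in>J. \<kappa> j \<in> insert t T} = B \<union> A" "B \<inter> A = {}" "finite A" "finite B"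
      using insert.hyps fin by (auto simp: A_def B_def)
    show ?case
      unfolding split(1) using split q
      by (intro bexI[of _ q]) (auto simp: G(2) prod.union_disjoint)
  qed (use F in auto)
  from this[of "\<kappa> ` J"] show ?thesis
    by (simp add: conj_absorb cong: conj_cong)
qed

text \<open>On the whole space pairwise coprime functionals form singleton classes, for which
  divisibility is vanishing on the kernel.\<close>

lemma prod_dvd_if_vanishes_on_kernels:
  fixes b :: "'i \<Rightarrow> 'g::euclidean_space \<Rightarrow>\<^sub>L real"
  assumes H: "subspace H" "\<And>j. j \<in> J \<Longrightarrow> b j \<in> H"
    and fin: "finite J"
    and nz: "\<And>j. j \<in> J \<Longrightarrow> \<exists>x. b j x \<noteq> 0"
    and coprime: "\<And>i j. i \<in> J \<Longrightarrow> j \<in> J \<Longrightarrow> i \<noteq> j \<Longrightarrow> \<exists>x. b j x = 0 \<and> b i x \<noteq> 0"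
    and F: "F \<in> sym_alg H"
    and vanish: "\<And>j x. j \<in> J \<Longrightarrow> b j x = 0 \<Longrightarrow> F x = 0"
  shows "\<exists>q\<in>sym_alg H. \<forall>x. F x = (\<Prod>j\<in>J. b j x) * q x"
proof -
  have "\<exists>q\<in>sym_alg H. \<forall>x\<in>UNIV. F x = (\<Prod>j\<in>J. b j x) * q x"
  proof (rule prod_dvd_if_classes_dvd[where \<kappa> = id])
    fix i assume i: "i \<in> J"
    then obtain w where w: "b i w \<noteq> 0"
      using nz by blast
    have "{j \<in> J. id j = id i} = {i}"
      using i by auto
    then show "\<exists>q\<in>sym_alg H. \<forall>x\<in>UNIV. F x = (\<Prod>j\<in>{j \<in> J. id j = id i}. b j x) * q x"
      using linear_dvd_iff_vanishes_on_kernel[OF H(1) H(2)[OF i] subspace_UNIV UNIV_I w F] vanish[OF i]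
      by simp
  qed (use assms in auto)
  then show ?thesis
    by simp
qed

section \<open>Interpolation on hyperplanes\<close>

text \<open>Eliminate one functional at a time: if \<open>v\<close> is killed by \<open>A\<close>
  but not by \<open>a\<close>, subtracting a multiple of \<open>a\<close> makes \<open>b\<close>
  vanish at \<open>v\<close> as well; if there is no such \<open>v\<close>, then \<open>a\<close>
  adds no condition.\<close>

lemma in_span_if_vanishes_on_common_kernel:
  fixes A :: "('g::euclidean_space \<Rightarrow>\<^sub>L real) set"
  assumes "finite A" "\<And>x. (\<And>a. a \<in> A \<Longrightarrow> blinfun_apply a x = 0) \<Longrightarrow> blinfun_apply b x = 0"
  shows "b \<in> span A"
  using assms
proof (induction A arbitrary: b rule: finite_induct)
  case empty
  then have "b = 0"
    by (intro blinfun_eqI) simp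
  then show ?case
    by (simp add: span_zero)
next
  case (insert a A)
  show ?case
  proof (cases "\<exists>v. (\<forall>c\<in>A. blinfun_apply c v = 0) \<and> a v \<noteq> 0")
    case True
    then obtain v where v: "\<And>c. c \<in> A \<Longrightarrow> blinfun_apply c v = 0" "a v \<noteq> 0"
      by blast
    define k where "k = b v / a v"
    have "b - k *\<^sub>R a \<in> span A"
    proof (rule insert.IH)
      fix x assume x: "\<And>c. c \<in> A \<Longrightarrow> blinfun_apply c x = 0"
      have "b (x - (a x / a v) *\<^sub>R v) = 0"
        using x v by (intro insert.prems) (auto simp: blinfun.diff_right blinfun.scaleR_right)
      then show "blinfun_apply (b - k *\<^sub>R a) x = 0"
        by (simp add: k_def blinfun.diff_right blinfun.scaleR_right blinfun.diff_left blinfun.scaleR_left)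
    qed
    then show ?thesis
      by (auto simp: span_insert)
  next
    case False
    then have "b \<in> span A"
      using insert by (metis insert_iff)
    then show ?thesis
      by (meson span_mono subset_insertI subsetD)
  qed
qed

text \<open>Composition with \<pi> is a projection of the dual space onto \<open>span A\<close>. It
  serves to turn arbitrary polynomial functions into elements of
  \<open>sym_alg (span A)\<close>.\<close>

lemma projection_onto_span:
  fixes A :: "('g::euclidean_space \<Rightarrow>\<^sub>L real) set"
  assumes "finite A"
  obtains \<pi> where "\<And>a x. a \<in> span A \<Longrightarrow> blinfun_apply a (\<pi> x) = blinfun_apply a x"
    "\<And>b. \<exists>b'\<in>span A. \<forall>x. blinfun_apply b (\<pi> x) = blinfun_apply b' x"
proof -
  have "\<exists>\<pi>. (\<forall>a\<in>A. \<forall>x. blinfun_apply a (\<pi> x) = blinfun_apply a x) \<and>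
    (\<forall>b. \<exists>b'\<in>span A. \<forall>x. blinfun_apply b (\<pi> x) = blinfun_apply b' x)"
    using assms
  proof (induction A rule: finite_induct)
    case empty
    show ?case
      by (intro exI[of _ "\<lambda>x. 0"]) simp
  next
    case (insert a A)
    then obtain \<pi> where \<pi>: "\<And>a x. a \<in> A \<Longrightarrow> blinfun_apply a (\<pi> x) = blinfun_apply a x"
      and ex: "\<forall>b. \<exists>b'\<in>span A. \<forall>x. blinfun_apply b (\<pi> x) = blinfun_apply b' x"
      by blast
    have sub: "span A \<subseteq> span (insert a A)"
      by (intro span_mono) auto
    show ?case
    proof (cases "\<exists>v. (\<forall>c\<in>A. blinfun_apply c v = 0) \<and> a v \<noteq> 0")
      case True
      then obtain v where v: "\<And>c. c \<in> A \<Longrightarrow> blinfun_apply c v = 0" "a v \<noteq> 0"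
        by blast
      \<comment> \<open>A multiple of \<open>v\<close> corrects the value of \<open>a\<close> and
        leaves the functionals in \<open>A\<close> untouched.\<close>
      define \<pi>' where "\<pi>' x = \<pi> x + ((a x - a (\<pi> x)) / a v) *\<^sub>R v" for x
      obtain a' where a': "a' \<in> span A" "\<And>x. a (\<pi> x) = blinfun_apply a' x"
        using ex by blast
      have "\<exists>b'\<in>span (insert a A). \<forall>x. blinfun_apply b (\<pi>' x) = blinfun_apply b' x" for b
      proof -
        obtain b' where b': "b' \<in> span A" "\<And>x. blinfun_apply b (\<pi> x) = blinfun_apply b' x"
          using ex by blast
        have "b' + (b v / a v) *\<^sub>R (a - a') \<in> span (insert a A)"
          using a' b' sub by (intro span_add span_scale span_diff) (auto simp: span_base)
        moreover have "b (\<pi>' x) = (b' + (b v / a v) *\<^sub>R (a - a')) x" for x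
          using a' b' by (simp add: \<pi>'_def blinfun.add_right blinfun.scaleR_right
              blinfun.add_left blinfun.scaleR_left blinfun.diff_left)
        ultimately show ?thesis
          by blast
      qed
      then show ?thesis
        using v \<pi> by (intro exI[of _ \<pi>']) (auto simp: \<pi>'_def blinfun.add_right blinfun.scaleR_right)
    next
      case False
      \<comment> \<open>Here \<open>a\<close> vanishes on the common kernel of \<open>A\<close>, so
        \<pi> already preserves it.\<close>
      have "\<forall>c\<in>A. blinfun_apply c (\<pi> x - x) = 0" for x
        using \<pi> by (simp add: blinfun.diff_right)
      then have "a (\<pi> x - x) = 0" for x
        using False by blast
      then have "\<forall>c\<in>insert a A. \<forall>x. blinfun_apply c (\<pi> x) = blinfun_apply c x"
        using \<pi> by (simp add: blinfun.diff_right)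
      moreover have "\<forall>b. \<exists>b'\<in>span (insert a A). \<forall>x. blinfun_apply b (\<pi> x) = blinfun_apply b' x"
        using ex sub by (meson subsetD)
      ultimately show ?thesis
        by blast
    qed
  qed
  then obtain \<pi> where \<pi>: "\<And>a x. a \<in> A \<Longrightarrow> blinfun_apply a (\<pi> x) = blinfun_apply a x"
    "\<And>b. \<exists>b'\<in>span A. \<forall>x. blinfun_apply b (\<pi> x) = blinfun_apply b' x"
    by blast
  have "blinfun_apply a (\<pi> x) = blinfun_apply a x" if "a \<in> span A" for a x
    using that by (induction rule: span_induct_alt)
      (auto simp: \<pi>(1) blinfun.add_left blinfun.scaleR_left)
  with \<pi>(2) that show ?thesis
    by blast
qed

text \<open>Add hyperplanes one by one. A solution \<open>g0\<close> for \<open>I\<close> may be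
  changed by multiples of the product over \<open>I\<close>, so it suffices that
  \<open>f m - g0\<close> is divisible by this product on the kernel of \<open>a m\<close>. There
  the factors fall into classes, one for each plane through \<open>a m\<close>, and the local
  solution for a plane gives divisibility by its class.\<close>

lemma interpolation_local_in_codimension_two:
  fixes a :: "'i \<Rightarrow> 'g::euclidean_space \<Rightarrow>\<^sub>L real"
  assumes "finite I"
    and indep: "\<And>i j. i \<in> I \<Longrightarrow> j \<in> I \<Longrightarrow> i \<noteq> j \<Longrightarrow> a i \<noteq> a j \<and> independent {a i, a j}"
    and nz: "\<And>i. i \<in> I \<Longrightarrow> a i \<noteq> 0"
    and f: "\<And>i. i \<in> I \<Longrightarrow> f i \<in> sym_alg UNIV"
    and local: "\<And>i j. i \<in> I \<Longrightarrow> j \<in> I \<Longrightarrow> i \<noteq> j \<Longrightarrow>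
      \<exists>g\<in>sym_alg UNIV. \<forall>k\<in>I. a k \<in> span {a i, a j} \<longrightarrow> (\<forall>x. a k x = 0 \<longrightarrow> g x = f k x)"
  shows "\<exists>g\<in>sym_alg UNIV. \<forall>k\<in>I. \<forall>x. a k x = 0 \<longrightarrow> g x = f k x"
  using assms
proof (induction I rule: finite_induct)
  case empty
  then show ?case
    by (intro bexI[OF _ sym_alg.const]) simp
next
  case (insert m I)
  note indep = insert.prems(1) and nz = insert.prems(2) and f = insert.prems(3) and local = insert.prems(4)
  have "\<exists>g\<in>sym_alg UNIV. \<forall>k\<in>I. \<forall>x. a k x = 0 \<longrightarrow> g x = f k x"
  proof (rule insert.IH)
    fix i j assume "i \<in> I" "j \<in> I" "i \<noteq> j"
    then obtain g where "g \<in> sym_alg UNIV"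
      "\<forall>k\<in>insert m I. a k \<in> span {a i, a j} \<longrightarrow> (\<forall>x. a k x = 0 \<longrightarrow> g x = f k x)"
      using local[of i j] by (meson insertI2)
    then show "\<exists>g\<in>sym_alg UNIV. \<forall>k\<in>I. a k \<in> span {a i, a j} \<longrightarrow> (\<forall>x. a k x = 0 \<longrightarrow> g x = f k x)"
      by (intro bexI[of _ g]) simp_all
  qed (use indep nz f in auto)
  then obtain g0 where g0: "g0 \<in> sym_alg UNIV" "\<And>k x. k \<in> I \<Longrightarrow> a k x = 0 \<Longrightarrow> g0 x = f k x"
    by blast
  define K where "K = {x. a m x = 0}"
  have K: "subspace K"
    unfolding K_def subspace_def by (auto simp: blinfun.add_right blinfun.scaleR_right)
  \<comment> \<open>Functionals in one plane through \<open>a m\<close> become proportional on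
    \<open>K\<close>; those in different planes stay coprime there.\<close>
  define \<kappa> where "\<kappa> i = span {a i, a m}" for i
  have nz': "\<exists>x. a i x \<noteq> 0" if "i \<in> insert m I" for i
    using nz[OF that] by (metis blinfun_eqI zero_blinfun.rep_eq)
  have ker2: "\<exists>x. a j x = 0 \<and> a i x \<noteq> 0" if "i \<in> insert m I" "j \<in> insert m I" "i \<noteq> j" for i j
  proof (rule ccontr)
    assume "\<not> ?thesis"
    then have "a i \<in> span {a j}"
      by (intro in_span_if_vanishes_on_common_kernel) auto
    moreover have "{a i, a j} - {a i} = {a j}"
      using indep[OF that] by auto
    ultimately show False
      using indep[OF that] by (auto simp: dependent_def)
  qed
  define F where "F x = f m x - g0 x" for x
  have "\<exists>q\<in>sym_alg UNIV. \<forall>x\<in>K. F x = (\<Prod>j\<in>I. a j x) * q x"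
  proof (rule prod_dvd_if_classes_dvd[where \<kappa> = \<kappa>, OF _ _ K insert.hyps(1)])
    show "\<exists>x\<in>K. a j x \<noteq> 0" if "j \<in> I" for j
      using ker2[of j m] that insert.hyps by (auto simp: K_def)
    show "F \<in> sym_alg UNIV"
      unfolding F_def using f g0 by (auto intro: sym_alg_diff)
    show "\<exists>x\<in>K. a j x = 0 \<and> a i x \<noteq> 0" if "i \<in> I" "j \<in> I" "\<kappa> i \<noteq> \<kappa> j" for i j
    proof (rule ccontr)
      assume "\<not> ?thesis"
      then have *: "a i \<in> span {a j, a m}"
        by (intro in_span_if_vanishes_on_common_kernel) (auto simp: K_def)
      \<comment> \<open>This is what the exchange property requires in order to turn proportionality
        on \<open>K\<close> into equality of the two planes.\<close>
      have "a i \<notin> span {a m}"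
      proof
        assume "a i \<in> span {a m}"
        moreover have "i \<noteq> m" using that insert.hyps by auto
        then have "a i \<noteq> a m \<and> independent {a i, a m}" using indep that by auto
        moreover from this have "{a i, a m} - {a i} = {a m}"
          by auto
        ultimately show False
          by (auto simp: dependent_def)
      qed
      with * have "a j \<in> span {a i, a m}"
        by (rule in_span_insert)
      with * have "\<kappa> i = \<kappa> j"
        unfolding \<kappa>_def by (auto simp: span_eq span_base)
      with that show False by simp
    qed
    fix i assume i: "i \<in> I"
    then have "i \<noteq> m"
      using insert.hyps by auto
    then obtain g where g: "g \<in> sym_alg UNIV"
      "\<And>k x. k \<in> insert m I \<Longrightarrow> a k \<in> \<kappa> i \<Longrightarrow> a k x = 0 \<Longrightarrow> g x = f k x"
      using local[of i m] i unfolding \<kappa>_def by blast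
    define A where "A = {j\<in>I. \<kappa> j = \<kappa> i}"
    \<comment> \<open>For \<open>j\<close> in the class, \<open>g\<close> and \<open>g0\<close> both
      equal \<open>f j\<close> on the kernel of \<open>a j\<close>. On \<open>K\<close> moreover
      \<open>g\<close> equals \<open>f m\<close>, so the same quotient serves for
      \<open>F\<close>.\<close>
    have "\<exists>q\<in>sym_alg UNIV. \<forall>x. g x - g0 x = (\<Prod>j\<in>A. a j x) * q x"
    proof (rule prod_dvd_if_vanishes_on_kernels)
      show "g x - g0 x = 0" if "j \<in> A" "a j x = 0" for j x
      proof -
        have "a j \<in> \<kappa> j" by (simp add: \<kappa>_def span_base)
        then show ?thesis
          using that g(2)[of j x] g0(2)[of j x] by (auto simp: A_def)
      qed
    qed (use insert.hyps nz' ker2 g g0 in \<open>auto simp: A_def intro: sym_alg_diff\<close>)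
    then obtain u where u: "u \<in> sym_alg UNIV" "\<And>x. g x - g0 x = (\<Prod>j\<in>A. a j x) * u x"
      by blast
    have "F x = (\<Prod>j\<in>A. a j x) * u x" if "x \<in> K" for x
    proof -
      have "a m \<in> \<kappa> i" by (simp add: \<kappa>_def span_base)
      then show ?thesis
        using that g(2)[of m x] u(2)[of x] by (auto simp: F_def K_def)
    qed
    with u(1) show "\<exists>q\<in>sym_alg UNIV. \<forall>x\<in>K. F x = (\<Prod>j\<in>{j \<in> I. \<kappa> j = \<kappa> i}. a j x) * q x"
      unfolding A_def by blast
  qed auto
  then obtain h where h: "h \<in> sym_alg UNIV" "\<And>x. x \<in> K \<Longrightarrow> F x = (\<Prod>j\<in>I. a j x) * h x"
    by blast
  show ?case
  \<comment> \<open>The correction vanishes on every old hyperplane and supplies the missing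
    difference on the new one.\<close>
  proof (intro bexI[of _ "\<lambda>x. g0 x + (\<Prod>j\<in>I. a j x) * h x"] ballI allI impI)
    fix k x assume k: "k \<in> insert m I" "a k x = 0"
    show "g0 x + (\<Prod>j\<in>I. a j x) * h x = f k x"
    proof (cases "k = m")
      case True
      with k h(2)[of x] show ?thesis by (simp add: K_def F_def)
    next
      case False
      with k have "k \<in> I" by auto
      with insert.hyps k have "(\<Prod>j\<in>I. a j x) = 0" by (auto simp: prod_zero_iff)
      with g0(2)[OF \<open>k \<in> I\<close> k(2)] show ?thesis by simp
    qed
  next
    show "(\<lambda>x. g0 x + (\<Prod>j\<in>I. a j x) * h x) \<in> sym_alg UNIV"
      by (intro sym_alg.add[OF g0(1)] sym_alg.mult[OF _ h(1)] sym_alg_prod sym_alg.linear UNIV_I)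
  qed
qed

section \<open>Homogeneous parts\<close>

text \<open>Lines through the origin reduce homogeneous components to coefficients in one variable,
  with no choice of coordinates. At most one polynomial fits the description, since real polynomials
  with equal values coincide.\<close>

definition homogeneous_part :: "nat \<Rightarrow> ('g::euclidean_space \<Rightarrow> real) \<Rightarrow> 'g \<Rightarrow> real" where
  "homogeneous_part k f x = coeff (THE P. \<forall>t. poly P t = f (t *\<^sub>R x)) k"

lemma homogeneous_part_eq_coeff:
  assumes "\<And>t. poly P t = f (t *\<^sub>R x)"
  shows "homogeneous_part k f x = coeff P k"
proof -
  have "(THE P. \<forall>t. poly P t = f (t *\<^sub>R x)) = P"
    using assms by (intro the_equality) (auto simp flip: poly_eq_poly_eq_iff)
  then show ?thesis
    by (simp add: homogeneous_part_def)
qed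

text \<open>A generator \<open>a\<close> becomes \<open>[:0, a x:]\<close>; sums and convolutions
  keep the coefficients, as functions of \<open>x\<close>, in the algebra.\<close>

lemma sym_alg_along_rays:
  assumes "f \<in> sym_alg H"
  obtains P where "\<And>x t. poly (P x) t = f (t *\<^sub>R x)" "\<And>k. (\<lambda>x. coeff (P x) k) \<in> sym_alg H"
proof -
  have "\<exists>P. (\<forall>x t. poly (P x) t = f (t *\<^sub>R x)) \<and> (\<forall>k. (\<lambda>x. coeff (P x) k) \<in> sym_alg H)"
    using assms
  proof induction
    case (linear a)
    have "(\<lambda>x. coeff [:0, a x:] k) \<in> sym_alg H" for k
    proof (cases "k = 1")
      case True
      then show ?thesis using sym_alg.linear[OF linear] by simp
    next
      case False
      then have "(\<lambda>x. coeff [:0, a x:] k) = (\<lambda>x. 0)"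
        by (auto simp: coeff_pCons split: nat.split)
      then show ?thesis by (simp add: sym_alg.const)
    qed
    then show ?case
      by (intro exI[of _ "\<lambda>x. [:0, a x:]"]) (simp add: blinfun.scaleR_right)
  next
    case (const c)
    have "(\<lambda>x. coeff [:c:] k) \<in> sym_alg H" for k
      by (rule sym_alg.const)
    then show ?case
      by (intro exI[of _ "\<lambda>x. [:c:]"]) simp
  next
    case (add f g)
    then obtain P Q where P: "\<forall>x t. poly (P x) t = f (t *\<^sub>R x)" "\<forall>k. (\<lambda>x. coeff (P x) k) \<in> sym_alg H"
      and Q: "\<forall>x t. poly (Q x) t = g (t *\<^sub>R x)" "\<forall>k. (\<lambda>x. coeff (Q x) k) \<in> sym_alg H"
      by blast
    have "(\<lambda>x. coeff (P x + Q x) k) \<in> sym_alg H" for k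
      unfolding coeff_add using P(2) Q(2) by (intro sym_alg.add) simp_all
    then show ?case
      using P(1) Q(1) by (intro exI[of _ "\<lambda>x. P x + Q x"]) simp
  next
    case (mult f g)
    then obtain P Q where P: "\<forall>x t. poly (P x) t = f (t *\<^sub>R x)" "\<forall>k. (\<lambda>x. coeff (P x) k) \<in> sym_alg H"
      and Q: "\<forall>x t. poly (Q x) t = g (t *\<^sub>R x)" "\<forall>k. (\<lambda>x. coeff (Q x) k) \<in> sym_alg H"
      by blast
    have "(\<lambda>x. coeff (P x * Q x) k) \<in> sym_alg H" for k
      unfolding coeff_mult using P(2) Q(2) by (intro sym_alg_sum sym_alg.mult) simp_all
    then show ?case
      using P(1) Q(1) by (intro exI[of _ "\<lambda>x. P x * Q x"]) simp
  qed
  with that show ?thesis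
    by blast
qed

lemma sym_alg_homogeneous_part:
  assumes "f \<in> sym_alg H"
  shows "homogeneous_part k f \<in> sym_alg H"
proof -
  obtain P where P: "\<And>x t. poly (P x) t = f (t *\<^sub>R x)" "\<And>k. (\<lambda>x. coeff (P x) k) \<in> sym_alg H"
    using sym_alg_along_rays[OF assms] by blast
  have "homogeneous_part k f = (\<lambda>x. coeff (P x) k)"
    by (intro ext homogeneous_part_eq_coeff P)
  with P(2) show ?thesis
    by simp
qed

lemma homogeneous_part_cong:
  "(\<And>t. f (t *\<^sub>R x) = g (t *\<^sub>R x)) \<Longrightarrow> homogeneous_part k f x = homogeneous_part k g x"
  by (simp add: homogeneous_part_def)

lemma homogeneous_part_zero [simp]: "homogeneous_part k (\<lambda>x. 0) = (\<lambda>x. 0)"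
proof
  show "homogeneous_part k (\<lambda>x. 0) x = 0" for x :: 'a
    using homogeneous_part_eq_coeff[of 0 "\<lambda>x. 0" x k] by simp
qed

text \<open>Along a ray the product is a monomial of degree \<open>card I\<close>, so only the
  constant term of \<open>u\<close> contributes in that degree.\<close>

lemma homogeneous_part_prod_linear_mult:
  fixes a :: "'i \<Rightarrow> 'g::euclidean_space \<Rightarrow>\<^sub>L real"
  assumes "u \<in> sym_alg H"
  shows "homogeneous_part (card I) (\<lambda>x. (\<Prod>i\<in>I. a i x) * u x) x = (\<Prod>i\<in>I. a i x) * u 0"
proof -
  obtain P where P: "\<And>x t. poly (P x) t = u (t *\<^sub>R x)" "\<And>k. (\<lambda>x. coeff (P x) k) \<in> sym_alg H"
    using sym_alg_along_rays[OF assms] by blast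
  have "homogeneous_part (card I) (\<lambda>x. (\<Prod>i\<in>I. a i x) * u x) x =
      coeff (monom (\<Prod>i\<in>I. a i x) (card I) * P x) (card I)"
    by (rule homogeneous_part_eq_coeff)
      (simp add: P(1) poly_monom blinfun.scaleR_right prod.distrib)
  also have "\<dots> = (\<Prod>i\<in>I. a i x) * poly (P x) 0"
    by (simp add: coeff_monom_mult poly_0_coeff_0)
  finally show ?thesis
    by (simp add: P(1))
qed

section \<open>Extension of partial classes\<close>

text \<open>These assumptions pass to the components of every restriction to a subspace, so the same
  results apply to the whole graph and to its components.\<close>

locale morse_skeleton = fin_digraph G
  for G :: "('v, 'e) pre_digraph" +
  fixes \<alpha> :: "'e \<Rightarrow> ('g::euclidean_space \<Rightarrow>\<^sub>L real)"
    and \<xi> :: 'g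
    and \<phi> :: "'v \<Rightarrow> real"
  assumes reverse_arc:
      "e \<in> arcs G \<Longrightarrow> \<exists>e'\<in>arcs G. tail G e' = head G e \<and> head G e' = tail G e \<and> \<alpha> e' = - \<alpha> e"
    and axial_independent:
      "\<lbrakk>e \<in> arcs G; e' \<in> arcs G; tail G e = tail G e'; e \<noteq> e'\<rbrakk> \<Longrightarrow> \<alpha> e \<noteq> \<alpha> e' \<and> independent {\<alpha> e, \<alpha> e'}"
    and polarizing: "e \<in> arcs G \<Longrightarrow> \<alpha> e \<xi> \<noteq> 0"
    and compatible: "\<lbrakk>e \<in> arcs G; \<alpha> e \<xi> > 0\<rbrakk> \<Longrightarrow> \<phi> (tail G e) < \<phi> (head G e)"
    and inj: "inj_on \<phi> (verts G)"
begin

definition descending :: "'v \<Rightarrow> 'e set" where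
  "descending v = {e \<in> out_arcs G v. \<alpha> e \<xi> < 0}"

definition below :: "'v \<Rightarrow> 'v set" where
  "below v = {w \<in> verts G. \<phi> w < \<phi> v}"

definition partial_class :: "('g \<Rightarrow>\<^sub>L real) set \<Rightarrow> 'v set \<Rightarrow> ('v \<Rightarrow> 'g \<Rightarrow> real) \<Rightarrow> bool" where
  "partial_class H U f \<longleftrightarrow> (\<forall>v\<in>U. f v \<in> sym_alg H) \<and>
    (\<forall>e\<in>arcs G. tail G e \<in> U \<longrightarrow> head G e \<in> U \<longrightarrow>
      (\<forall>x. \<alpha> e x = 0 \<longrightarrow> f (tail G e) x = f (head G e) x))"

text \<open>The descending edges are those joining \<open>v\<close> to vertices where
  \<open>f\<close> is already fixed, so \<open>g\<close> is an admissible value at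
  \<open>v\<close>.\<close>

definition extendable :: "('g \<Rightarrow>\<^sub>L real) set \<Rightarrow> bool" where
  "extendable H \<longleftrightarrow> (\<forall>v\<in>verts G. \<forall>f. partial_class H (below v) f \<longrightarrow>
    (\<exists>g\<in>sym_alg H. \<forall>e\<in>descending v. \<forall>x. \<alpha> e x = 0 \<longrightarrow> g x = f (head G e) x))"

text \<open>Vanishing is required on sublevel sets of \<phi> instead of outside flow-ups. Sublevel
  sets restrict well to a component, whereas a flow-up of the component may be smaller than the
  trace of the ambient one.\<close>

definition morse_family :: "('g \<Rightarrow>\<^sub>L real) set \<Rightarrow> ('v \<Rightarrow> 'v \<Rightarrow> 'g \<Rightarrow> real) \<Rightarrow> bool" where
  "morse_family H \<tau> \<longleftrightarrow> (\<forall>p\<in>verts G. partial_class H (verts G) (\<tau> p) \<and>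
    (\<forall>q\<in>below p. \<tau> p q = (\<lambda>x. 0)) \<and> \<tau> p p = (\<lambda>x. \<Prod>e\<in>descending p. \<alpha> e x))"

section \<open>Edges and partial classes\<close>

lemma axial_nonzero: "e \<in> arcs G \<Longrightarrow> \<exists>x. \<alpha> e x \<noteq> 0"
  using polarizing by blast

lemma axial_coprime:
  assumes "e \<in> arcs G" "e' \<in> arcs G" "tail G e = tail G e'" "e \<noteq> e'"
  shows "\<exists>x. \<alpha> e' x = 0 \<and> \<alpha> e x \<noteq> 0"
proof (rule ccontr)
  assume "\<not> ?thesis"
  then have "\<alpha> e \<in> span {\<alpha> e'}"
    by (intro in_span_if_vanishes_on_common_kernel) auto
  moreover have "{\<alpha> e, \<alpha> e'} - {\<alpha> e} = {\<alpha> e'}"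
    using axial_independent[OF assms] by auto
  ultimately show False
    using axial_independent[OF assms] by (auto simp: dependent_def)
qed

lemma descending_subset: "descending v \<subseteq> arcs G"
  by (auto simp: descending_def)

lemma finite_descending: "finite (descending v)"
  using finite_subset[OF descending_subset] by simp

text \<open>Compatibility speaks of ascending edges; applied to the reverse arc it also covers the
  descending ones.\<close>

lemma descending_iff:
  assumes "e \<in> arcs G"
  shows "e \<in> descending (tail G e) \<longleftrightarrow> \<phi> (head G e) < \<phi> (tail G e)"
proof -
  obtain e' where e': "e' \<in> arcs G" "tail G e' = head G e" "head G e' = tail G e" "\<alpha> e' = - \<alpha> e"
    using reverse_arc[OF assms] by blast
  then show ?thesis
    using polarizing[OF assms] compatible[OF assms] compatible[OF e'(1)] assms
    by (cases "\<alpha> e \<xi> < 0") (auto simp: descending_def blinfun.minus_left)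
qed

lemma no_loop: "e \<in> arcs G \<Longrightarrow> tail G e \<noteq> head G e"
  using descending_iff[of e] compatible[of e] polarizing[of e] by (force simp: descending_def)

lemma head_descending: "e \<in> descending v \<Longrightarrow> head G e \<in> below v"
  using descending_iff[of e] head_in_verts by (auto simp: descending_def below_def)

lemma tail_descending: "e \<in> descending v \<Longrightarrow> tail G e = v"
  by (auto simp: descending_def)

lemma partial_class_mono: "partial_class H U f \<Longrightarrow> H \<subseteq> H' \<Longrightarrow> W \<subseteq> U \<Longrightarrow> partial_class H' W f"
  unfolding partial_class_def using sym_alg_mono by blast

lemma partial_class_cong: "(\<And>v. v \<in> U \<Longrightarrow> f v = g v) \<Longrightarrow> partial_class H U f \<longleftrightarrow> partial_class H U g"
  by (simp add: partial_class_def)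

lemma partial_class_eq_on_kernel:
  "\<lbrakk>partial_class H U f; e \<in> arcs G; tail G e \<in> U; head G e \<in> U; \<alpha> e x = 0\<rbrakk> \<Longrightarrow>
    f (tail G e) x = f (head G e) x"
  by (simp add: partial_class_def)

lemma partial_class_add_mult:
  assumes f: "partial_class H U f" and g: "partial_class H U g" and h: "h \<in> sym_alg H"
  shows "partial_class H U (\<lambda>v x. f v x + h x * g v x)"
  unfolding partial_class_def
proof (intro conjI ballI impI allI)
  show "(\<lambda>x. f v x + h x * g v x) \<in> sym_alg H" if "v \<in> U" for v
    using that f g h unfolding partial_class_def
    by (intro sym_alg.add[of "f v"] sym_alg.mult[of h]) simp_all
qed (use f g in \<open>simp add: partial_class_def\<close>)

text \<open>There are no loops, so an edge of the enlarged set that meets \<open>v\<close> is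
  descending at \<open>v\<close> or has a descending reverse, which has the same kernel.\<close>

lemma partial_class_insert:
  assumes v: "v \<in> verts G" and f: "partial_class H (below v) f" and fv: "f v \<in> sym_alg H"
    and desc: "\<And>e x. e \<in> descending v \<Longrightarrow> \<alpha> e x = 0 \<Longrightarrow> f v x = f (head G e) x"
  shows "partial_class H (insert v (below v)) f"
  unfolding partial_class_def
proof (intro conjI ballI impI allI)
  show "f w \<in> sym_alg H" if "w \<in> insert v (below v)" for w
    using that f fv by (auto simp: partial_class_def)
  fix e x
  assume e: "e \<in> arcs G" "tail G e \<in> insert v (below v)" "head G e \<in> insert v (below v)"
    and x: "\<alpha> e x = 0"
  obtain e' where e': "e' \<in> arcs G" "tail G e' = head G e" "head G e' = tail G e" "\<alpha> e' = - \<alpha> e"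
    using reverse_arc[OF e(1)] by blast
  consider "tail G e \<in> below v" "head G e \<in> below v" | "tail G e = v" "head G e \<in> below v"
    | "head G e = v" "tail G e \<in> below v"
    using e(2,3) no_loop[OF e(1)] by auto
  then show "f (tail G e) x = f (head G e) x"
  proof cases
    case 1
    with f e x show ?thesis by (simp add: partial_class_def)
  next
    case 2
    then have "e \<in> descending v"
      using descending_iff[OF e(1)] by (simp add: below_def)
    with desc[OF this x] 2 show ?thesis by simp
  next
    case 3
    then have "e' \<in> descending v"
      using descending_iff[OF e'(1)] e' by (simp add: below_def)
    with desc[OF this, of x] 3 e' x show ?thesis by (simp add: blinfun.minus_left)
  qed
qed

text \<open>A nonempty lower set has a highest vertex \<open>v\<close>, unique because \<phi> is
  injective, and is then \<open>insert v (below v)\<close>.\<close>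

lemma lower_set_induct:
  assumes "U \<subseteq> verts G" "\<And>v. v \<in> U \<Longrightarrow> below v \<subseteq> U"
    and "P {}" "\<And>v. v \<in> U \<Longrightarrow> P (below v) \<Longrightarrow> P (insert v (below v))"
  shows "P U"
proof -
  have "finite U"
    using finite_subset[OF assms(1)] by simp
  then show ?thesis
    using assms
  proof (induction U rule: finite_psubset_induct)
    case (psubset U)
    show ?case
    proof (cases "U = {}")
      case False
      have "finite (\<phi> ` U)" "\<phi> ` U \<noteq> {}"
        using psubset.hyps False by auto
      then have "Max (\<phi> ` U) \<in> \<phi> ` U"
        by (rule Max_in)
      then obtain v where v: "v \<in> U" and "Max (\<phi> ` U) = \<phi> v"
        by (rule imageE)
      with psubset.hyps have max: "\<phi> w \<le> \<phi> v" if "w \<in> U" for w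
        using that Max_ge[of "\<phi> ` U" "\<phi> w"] by simp
      have U: "U = insert v (below v)"
      proof (intro equalityI subsetI)
        fix w assume w: "w \<in> U"
        then have "\<phi> w < \<phi> v \<or> w = v"
          using v max[OF w] inj psubset.prems(1) by (metis inj_on_eq_iff less_le subsetD)
        with w psubset.prems(1) show "w \<in> insert v (below v)"
          by (auto simp: below_def)
      qed (use v psubset.prems(2) in auto)
      have "P (below v)"
      proof (rule psubset.IH)
        show "below v \<subset> U"
          using U by (auto simp: below_def)
        show "P (insert w (below w))" if "w \<in> below v" "P (below w)" for w
          using that psubset.prems(4) U by blast
      qed (auto simp: below_def psubset.prems(3))
      with psubset.prems(4)[OF v] U show ?thesis
        by simp
    qed (use psubset.prems(3) in simp)
  qed
qed

lemma sym_alg_prod_descending: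
  assumes "\<alpha> ` arcs G \<subseteq> H"
  shows "(\<lambda>x. \<Prod>e\<in>descending v. \<alpha> e x) \<in> sym_alg H"
  using assms descending_subset by (intro sym_alg_prod sym_alg.linear) blast

lemma prod_descending_eq_0:
  "e \<in> descending v \<Longrightarrow> \<alpha> e x = 0 \<Longrightarrow> (\<Prod>e\<in>descending v. \<alpha> e x) = 0"
  using finite_descending by (auto simp: prod_zero_iff)

text \<open>Each axial function is nonzero at \<xi>, so divisibility by it within
  \<open>sym_alg H\<close> is vanishing on its kernel.\<close>

lemma cohomology_iff_partial_class:
  assumes H: "subspace H" "\<alpha> ` arcs G \<subseteq> H"
  shows "f \<in> cohomology G \<alpha> H \<longleftrightarrow> partial_class H (verts G) f"
proof -
  have "(\<exists>q\<in>sym_alg H. \<forall>x. f (tail G e) x - f (head G e) x = \<alpha> e x * q x) \<longleftrightarrow>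
      (\<forall>x. \<alpha> e x = 0 \<longrightarrow> f (tail G e) x = f (head G e) x)"
    if "e \<in> arcs G" "\<forall>p\<in>verts G. f p \<in> sym_alg H" for e
  proof -
    have "\<alpha> e \<in> H" "\<alpha> e \<xi> \<noteq> 0" "(\<lambda>x. f (tail G e) x - f (head G e) x) \<in> sym_alg H"
      using that H polarizing by (auto intro!: sym_alg_diff)
    from linear_dvd_iff_vanishes_on_kernel[OF H(1) this(1) subspace_UNIV UNIV_I this(2,3)]
    show ?thesis by simp
  qed
  then show ?thesis
    by (auto simp: cohomology_def partial_class_def)
qed

section \<open>Flow-ups and sublevel sets\<close>

lemma wf_orient: "wf_digraph (orient G \<alpha> \<xi>)"
  by unfold_locales (auto simp: orient_def)

lemma le_flow_up:
  assumes "q \<in> flow_up G \<alpha> \<xi> p"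
  shows "\<phi> p \<le> \<phi> q"
proof -
  have "p \<rightarrow>\<^sup>*\<^bsub>orient G \<alpha> \<xi>\<^esub> q"
    using assms by (simp add: flow_up_def)
  then show ?thesis
  proof (induction rule: wf_digraph.reachable_induct[OF wf_orient, consumes 1, case_names base step])
    case (step x y)
    then obtain e where "e \<in> arcs G" "\<alpha> e \<xi> > 0" "tail G e = x" "head G e = y"
      by (auto simp: orient_def arcs_ends_def arc_to_ends_def)
    with compatible[of e] step show ?case by simp
  qed simp
qed

lemma flow_up_refl: "p \<in> verts G \<Longrightarrow> p \<in> flow_up G \<alpha> \<xi> p"
  using wf_digraph.reachable_refl[OF wf_orient] by (simp add: flow_up_def orient_def)

text \<open>The reverse of a descending edge is oriented towards \<open>v\<close>. Consequently
  descending edges from a vertex outside a flow-up end outside it, and a class can be continued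
  there by zero.\<close>

lemma flow_up_step:
  assumes "e \<in> descending v" "head G e \<in> flow_up G \<alpha> \<xi> p"
  shows "v \<in> flow_up G \<alpha> \<xi> p"
proof -
  from assms have e: "e \<in> arcs G" "tail G e = v" "\<alpha> e \<xi> < 0"
    by (auto simp: descending_def)
  obtain e' where e': "e' \<in> arcs G" "tail G e' = head G e" "head G e' = tail G e" "\<alpha> e' = - \<alpha> e"
    using reverse_arc[OF e(1)] by blast
  then have "head G e \<rightarrow>\<^bsub>orient G \<alpha> \<xi>\<^esub> v"
    using e by (auto simp: orient_def arcs_ends_def arc_to_ends_def blinfun.minus_left intro!: rev_image_eqI[of e'])
  with assms(2) show ?thesis
    unfolding flow_up_def using wf_digraph.reachable_adj_trans[OF wf_orient] by blast
qed

text \<open>Along the flow \<phi> does not decrease, so \<open>below p\<close> is disjoint from the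
  flow-up of \<open>p\<close>.\<close>

lemma generating_family_imp_morse_family:
  assumes H: "subspace H" "\<alpha> ` arcs G \<subseteq> H" and "admits_generating_family G \<alpha> H \<xi>"
  shows "\<exists>\<tau>. morse_family H \<tau>"
proof -
  obtain \<tau> where \<tau>: "\<And>p. p \<in> verts G \<Longrightarrow> generating_class G \<alpha> H \<xi> p (\<tau> p)"
    using assms(3) unfolding admits_generating_family_def by blast
  have "\<tau> p q = (\<lambda>x. 0)" if "p \<in> verts G" "q \<in> below p" for p q
    using \<tau>[OF that(1)] that(2) le_flow_up[of q p]
    by (fastforce simp: generating_class_def below_def)
  with \<tau> have "morse_family H \<tau>"
    unfolding morse_family_def generating_class_def cohomology_iff_partial_class[OF H] descending_def
    by blast
  then show ?thesis
    by blast
qed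

lemma morse_family_mono: "morse_family H \<tau> \<Longrightarrow> H \<subseteq> H' \<Longrightarrow> morse_family H' \<tau>"
  unfolding morse_family_def using partial_class_mono by blast

text \<open>A partial class on \<open>below v\<close> is the restriction of a global class
  \<open>F\<close>, assembled bottom-up from multiples of the family members; \<open>F v\<close> is
  then the value sought.\<close>

lemma morse_family_imp_extendable:
  assumes H: "subspace H" "\<alpha> ` arcs G \<subseteq> H" and \<tau>: "morse_family H \<tau>"
  shows "extendable H"
  unfolding extendable_def
proof (intro ballI allI impI)
  fix v f assume v: "v \<in> verts G" and f: "partial_class H (below v) f"
  have "\<exists>F. partial_class H (verts G) F \<and> (\<forall>w\<in>below v. F w = f w)"
  proof (rule lower_set_induct[where U = "below v"])
    have "partial_class H (verts G) (\<lambda>_ _. 0)"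
      by (simp add: partial_class_def sym_alg.const)
    then show "\<exists>F. partial_class H (verts G) F \<and> (\<forall>w\<in>{}. F w = f w)"
      by blast
  next
    fix w assume w: "w \<in> below v"
      and "\<exists>F. partial_class H (verts G) F \<and> (\<forall>u\<in>below w. F u = f u)"
    then obtain F where F: "partial_class H (verts G) F" "\<And>u. u \<in> below w \<Longrightarrow> F u = f u"
      by blast
    have wG: "w \<in> verts G" and ww: "w \<notin> below w" and sub: "below w \<subseteq> below v"
      using w by (auto simp: below_def)
    have "\<exists>h\<in>sym_alg H. \<forall>x. f w x - F w x = (\<Prod>e\<in>descending w. \<alpha> e x) * h x"
    proof (rule prod_dvd_if_vanishes_on_kernels[OF H(1) _ finite_descending])
      show "\<alpha> e \<in> H" if "e \<in> descending w" for e
        using that descending_subset H by blast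
      show "\<exists>x. \<alpha> e x \<noteq> 0" if "e \<in> descending w" for e
        using that descending_subset axial_nonzero by blast
      show "\<exists>x. \<alpha> e' x = 0 \<and> \<alpha> e x \<noteq> 0"
        if "e \<in> descending w" "e' \<in> descending w" "e \<noteq> e'" for e e'
        using that descending_subset tail_descending by (intro axial_coprime) blast+
      show "(\<lambda>x. f w x - F w x) \<in> sym_alg H"
        using f F w wG by (intro sym_alg_diff) (auto simp: partial_class_def)
      show "f w x - F w x = 0" if "e \<in> descending w" "\<alpha> e x = 0" for e x
      proof -
        have e: "e \<in> arcs G" "tail G e = w" "head G e \<in> below w" "head G e \<in> verts G"
          using that descending_subset tail_descending head_descending by (auto simp: below_def)
        have "f w x = f (head G e) x"
          using partial_class_eq_on_kernel[OF f e(1) _ _ that(2)] e w sub by auto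
        moreover have "F w x = F (head G e) x"
          using partial_class_eq_on_kernel[OF F(1) e(1) _ _ that(2)] e wG by auto
        ultimately show ?thesis
          using F(2) e by simp
      qed
    qed
    then obtain h where h: "h \<in> sym_alg H"
      "\<And>x. f w x - F w x = (\<Prod>e\<in>descending w. \<alpha> e x) * h x"
      by blast
    have \<tau>w: "partial_class H (verts G) (\<tau> w)" "\<And>u. u \<in> below w \<Longrightarrow> \<tau> w u = (\<lambda>x. 0)"
      "\<tau> w w = (\<lambda>x. \<Prod>e\<in>descending w. \<alpha> e x)"
      using \<tau> wG by (auto simp: morse_family_def)
    \<comment> \<open>Since \<open>\<tau> w\<close> is zero below \<open>w\<close>, the earlier
      agreement survives, while at \<open>w\<close> the divisibility just shown makes up the
      difference.\<close>
    define F' where "F' u = (\<lambda>x. F u x + h x * \<tau> w u x)" for u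
    have "partial_class H (verts G) F'"
      unfolding F'_def by (rule partial_class_add_mult[OF F(1) \<tau>w(1) h(1)])
    moreover have "F' u = f u" if "u \<in> insert w (below w)" for u
    proof (cases "u = w")
      case True
      then show ?thesis
        using h(2) by (auto simp: F'_def \<tau>w(3) algebra_simps fun_eq_iff)
    next
      case False
      with that show ?thesis
        by (simp add: F'_def \<tau>w(2) F(2))
    qed
    ultimately show "\<exists>F. partial_class H (verts G) F \<and> (\<forall>u\<in>insert w (below w). F u = f u)"
      by blast
  qed (auto simp: below_def)
  then obtain F where F: "partial_class H (verts G) F" "\<And>w. w \<in> below v \<Longrightarrow> F w = f w"
    by blast
  have "F v x = f (head G e) x" if "e \<in> descending v" "\<alpha> e x = 0" for e x
  proof -
    have e: "e \<in> arcs G" "tail G e = v" "head G e \<in> below v"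
      using that descending_subset tail_descending head_descending by auto
    then have "F v x = F (head G e) x"
      using partial_class_eq_on_kernel[OF F(1) e(1) _ _ that(2)] v by (auto simp: below_def)
    with F(2) e show ?thesis
      by simp
  qed
  moreover have "F v \<in> sym_alg H"
    using F v by (simp add: partial_class_def)
  ultimately show "\<exists>g\<in>sym_alg H. \<forall>e\<in>descending v. \<forall>x. \<alpha> e x = 0 \<longrightarrow> g x = f (head G e) x"
    by blast
qed

text \<open>The class at \<open>p\<close> is built upwards along \<phi>. Values are free to choose
  by extendability only inside the flow-up; elsewhere zero is consistent, which restores vanishing
  outside the flow-up.\<close>

lemma extendable_imp_generating_family:
  assumes H: "subspace H" "\<alpha> ` arcs G \<subseteq> H" and ext: "extendable H"
  shows "admits_generating_family G \<alpha> H \<xi>"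
proof -
  have "\<exists>\<tau>. generating_class G \<alpha> H \<xi> p \<tau>" if p: "p \<in> verts G" for p
  proof -
    let ?F = "flow_up G \<alpha> \<xi> p"
    let ?P = "\<lambda>x. \<Prod>e\<in>descending p. \<alpha> e x"
    \<comment> \<open>The implication is trivial for \<open>p\<close> itself but not for smaller
      lower sets, where the value at \<open>p\<close> is prescribed only once \<open>p\<close> is
      reached.\<close>
    have "\<exists>f. partial_class H (verts G) f \<and> (\<forall>v\<in>verts G - ?F. f v = (\<lambda>x. 0)) \<and> (p \<in> verts G \<longrightarrow> f p = ?P)"
    proof (rule lower_set_induct[where U = "verts G"])
      fix v assume v: "v \<in> verts G"
        and "\<exists>f. partial_class H (below v) f \<and> (\<forall>w\<in>below v - ?F. f w = (\<lambda>x. 0)) \<and> (p \<in> below v \<longrightarrow> f p = ?P)"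
      then obtain f where f: "partial_class H (below v) f" "\<And>w. w \<in> below v \<Longrightarrow> w \<notin> ?F \<Longrightarrow> f w = (\<lambda>x. 0)"
        "p \<in> below v \<Longrightarrow> f p = ?P"
        by blast
      have "\<exists>g\<in>sym_alg H. (\<forall>e\<in>descending v. \<forall>x. \<alpha> e x = 0 \<longrightarrow> g x = f (head G e) x) \<and>
        (v \<notin> ?F \<longrightarrow> g = (\<lambda>x. 0)) \<and> (v = p \<longrightarrow> g = ?P)"
      proof -
        consider "v = p" | "v \<notin> ?F" "v \<noteq> p" | "v \<in> ?F" "v \<noteq> p"
          by blast
        then show ?thesis
        proof cases
          \<comment> \<open>All lower neighbours of \<open>p\<close> carry zero, and the product
            vanishes on the kernel of each descending edge.\<close>
          case 1
          have "f (head G e) x = 0" if "e \<in> descending v" for e x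
          proof -
            have "head G e \<in> below v"
              by (rule head_descending[OF that])
            moreover from this have "head G e \<notin> ?F"
              using le_flow_up[of "head G e" p] 1 by (auto simp: below_def)
            ultimately show ?thesis
              by (simp add: f(2))
          qed
          with 1 show ?thesis
            using sym_alg_prod_descending[OF H(2)] prod_descending_eq_0 flow_up_refl[OF p]
            by (intro bexI[of _ ?P]) simp_all
        next
          \<comment> \<open>Lower neighbours of \<open>v\<close> are outside the flow-up as well, so
            zero fits.\<close>
          case 2
          have "f (head G e) = (\<lambda>x. 0)" if "e \<in> descending v" for e
            using 2 flow_up_step[OF that] head_descending[OF that] by (intro f(2)) auto
          with 2 show ?thesis
            by (intro bexI[of _ "\<lambda>x. 0"]) (simp_all add: sym_alg.const)
        next
          case 3
          with ext f(1) v show ?thesis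
            unfolding extendable_def by blast
        qed
      qed
      then obtain g where g: "g \<in> sym_alg H"
        "\<And>e x. e \<in> descending v \<Longrightarrow> \<alpha> e x = 0 \<Longrightarrow> g x = f (head G e) x"
        "v \<notin> ?F \<Longrightarrow> g = (\<lambda>x. 0)" "v = p \<Longrightarrow> g = ?P"
        by blast
      have vv: "v \<notin> below v"
        by (simp add: below_def)
      define f' where "f' = f(v := g)"
      have f'_below: "f' w = f w" if "w \<in> below v" for w
        using that vv by (auto simp: f'_def)
      have "partial_class H (insert v (below v)) f'"
      proof (rule partial_class_insert[OF v])
        show "partial_class H (below v) f'"
          using f(1) partial_class_cong[of "below v" f' f, OF f'_below] by blast
        show "f' v \<in> sym_alg H"
          by (simp add: f'_def g(1))
        show "f' v x = f' (head G e) x" if "e \<in> descending v" "\<alpha> e x = 0" for e x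
          using g(2)[OF that] f'_below[OF head_descending[OF that(1)]] by (simp add: f'_def)
      qed
      moreover have "f' w = (\<lambda>x. 0)" if "w \<in> insert v (below v)" "w \<notin> ?F" for w
        using that g(3) f(2) by (auto simp: f'_def)
      moreover have "f' p = ?P" if "p \<in> insert v (below v)"
        using that g(4) f(3) by (auto simp: f'_def)
      ultimately show "\<exists>f. partial_class H (insert v (below v)) f \<and>
          (\<forall>w\<in>insert v (below v) - ?F. f w = (\<lambda>x. 0)) \<and> (p \<in> insert v (below v) \<longrightarrow> f p = ?P)"
        by blast
    qed (auto simp: below_def partial_class_def)
    then show ?thesis
      using p unfolding generating_class_def cohomology_iff_partial_class[OF H] descending_def by blast
  qed
  then show ?thesis
    unfolding admits_generating_family_def by metis
qed

end

section \<open>Components\<close>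

context sym_digraph
begin

text \<open>Connectedness refers to the symmetrized digraph; in a symmetric digraph this is the same
  as directed reachability.\<close>

lemma connected_subgraph_of_reachable:
  assumes sub: "subgraph H G" and conn: "connected H" and u: "u \<in> verts H"
  shows "subgraph H (G \<restriction> {w. u \<rightarrow>\<^sup>* w})"
proof -
  have reach: "u \<rightarrow>\<^sup>* w" if "w \<in> verts H" for w
  proof -
    have "u \<rightarrow>\<^sup>*\<^bsub>mk_symmetric H\<^esub> w"
      using conn u that by (auto simp: connected_def strongly_connected_def)
    then have "u \<rightarrow>\<^sup>*\<^bsub>mk_symmetric G\<^esub> w"
      by (rule pre_digraph.reachable_mono[OF _ subgraph_mk_symmetric[OF sub]])
    then show ?thesis
      by (simp only: reachable_mk_symmetric_eq[OF sym_arcs])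
  qed
  interpret H: wf_digraph H
    using sub by (auto simp: subgraph_def)
  have "tail H = tail G" "head H = head G"
    using sub by (auto simp: subgraph_def compatible_def)
  then have "tail G e \<in> verts H" "head G e \<in> verts H" if "e \<in> arcs H" for e
    using that H.tail_in_verts[of e] H.head_in_verts[of e] by auto
  moreover have "wf_digraph (G \<restriction> {w. u \<rightarrow>\<^sup>* w})"
    by (rule wellformed_induce_subgraph)
  ultimately show ?thesis
    using sub reach by (auto simp: subgraph_def compatible_def)
qed

text \<open>The reachable part is a strongly connected component, hence connected; it is maximal
  because it contains every connected subgraph through \<open>u\<close>.\<close>

lemma component_of_reachable:
  assumes "u \<in> verts G"
  shows "component_of (G \<restriction> {w. u \<rightarrow>\<^sup>* w}) G"
proof -
  let ?D = "G \<restriction> {w. u \<rightarrow>\<^sup>* w}"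
  have ind: "induced_subgraph ?D G" and sc: "strongly_connected ?D"
    using induce_reachable_is_in_sccs[OF assms] by (auto simp: sccs_def)
  have sub: "subgraph ?D G"
    using ind by (rule induced_imp_subgraph)
  interpret D: wf_digraph ?D
    using sub by (auto simp: subgraph_def)
  have conn: "connected ?D"
  proof (rule D.connectedI)
    show "verts ?D \<noteq> {}"
      using sc by (auto simp: strongly_connected_def)
    show "v \<rightarrow>\<^sup>*\<^bsub>mk_symmetric ?D\<^esub> w" if "v \<in> verts ?D" "w \<in> verts ?D" for v w
      using sc that by (intro D.reachable_mk_symmetricI) (auto simp: strongly_connected_def)
  qed
  have uD: "u \<in> verts ?D"
    using assms by simp
  have "H = ?D" if H: "subgraph ?D H" "subgraph H G" "connected H" for H
  proof -
    have "u \<in> verts H"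
      using uD H(1) by (auto simp: subgraph_def)
    from connected_subgraph_of_reachable[OF H(2,3) this] H(1) show ?thesis
      by (auto simp: subgraph_def compatible_def intro!: pre_digraph.equality)
  qed
  with sub conn show ?thesis
    unfolding component_of_def max_subgraph_def by blast
qed

text \<open>The reachable part is connected and contains \<open>C\<close>, so maximality of
  \<open>C\<close> forces equality.\<close>

lemma component_eq_reachable:
  assumes C: "component_of C G" and u: "u \<in> verts C"
  shows "C = G \<restriction> {w. u \<rightarrow>\<^sup>* w}"
proof -
  have sub: "subgraph C G" and conn: "connected C"
    and max: "\<And>H. H \<noteq> C \<Longrightarrow> subgraph C H \<Longrightarrow> subgraph H G \<Longrightarrow> \<not> connected H"
    using C by (auto simp: component_of_def max_subgraph_def)
  have "u \<in> verts G"
    using sub u by (auto simp: subgraph_def)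
  then have "subgraph (G \<restriction> {w. u \<rightarrow>\<^sup>* w}) G" "connected (G \<restriction> {w. u \<rightarrow>\<^sup>* w})"
    using component_of_reachable by (auto simp: component_of_def max_subgraph_def)
  with max connected_subgraph_of_reachable[OF sub conn u] show ?thesis
    by metis
qed

end

context morse_skeleton
begin

text \<open>A subspace is closed under negation, so reverse arcs survive the restriction.\<close>

lemma sym_digraph_restrict_skeleton:
  assumes "subspace H"
  shows "sym_digraph (restrict_skeleton G \<alpha> H)"
proof unfold_locales
  show "symmetric (restrict_skeleton G \<alpha> H)"
    unfolding symmetric_def
  proof (rule symI)
    fix u v assume "u \<rightarrow>\<^bsub>restrict_skeleton G \<alpha> H\<^esub> v"
    then obtain e where e: "e \<in> arcs G" "\<alpha> e \<in> H" "tail G e = u" "head G e = v"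
      by (auto simp: restrict_skeleton_def arcs_ends_def arc_to_ends_def)
    then obtain e' where "e' \<in> arcs G" "tail G e' = v" "head G e' = u" "\<alpha> e' = - \<alpha> e"
      using reverse_arc by blast
    with e assms show "v \<rightarrow>\<^bsub>restrict_skeleton G \<alpha> H\<^esub> u"
      by (auto simp: restrict_skeleton_def arcs_ends_def arc_to_ends_def subspace_neg
          intro!: rev_image_eqI[of e'])
  qed
qed (auto simp: restrict_skeleton_def)

context
  fixes H C
  assumes H: "subspace H" and C: "component_of C (restrict_skeleton G \<alpha> H)"
begin

text \<open>Being a full reachable set, a component contains every edge in direction
  \<open>H\<close> that leaves one of its vertices. Later arguments use this description in place of
  maximality.\<close>

lemma component_structure:
  "verts C \<subseteq> verts G" "tail C = tail G" "head C = head G"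
  "arcs C = {e \<in> arcs G. \<alpha> e \<in> H \<and> tail G e \<in> verts C}"
  "e \<in> arcs C \<Longrightarrow> head G e \<in> verts C"
proof -
  let ?R = "restrict_skeleton G \<alpha> H"
  interpret R: sym_digraph ?R
    by (rule sym_digraph_restrict_skeleton[OF H])
  have sub: "subgraph C ?R" and "verts C \<noteq> {}"
    using C by (auto simp: component_of_def pre_digraph.max_subgraph_def connected_def strongly_connected_def)
  then obtain u where "u \<in> verts C"
    by blast
  from R.component_eq_reachable[OF C this]
  have eq: "C = ?R \<restriction> {w. u \<rightarrow>\<^sup>*\<^bsub>?R\<^esub> w}" .
  show "verts C \<subseteq> verts G" "tail C = tail G" "head C = head G"
    using sub by (auto simp: subgraph_def compatible_def restrict_skeleton_def)
  have step: "u \<rightarrow>\<^sup>*\<^bsub>?R\<^esub> head G e" if "e \<in> arcs G" "\<alpha> e \<in> H" "u \<rightarrow>\<^sup>*\<^bsub>?R\<^esub> tail G e" for e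
    using R.reachable_adj_trans[OF that(3), of "head G e"] that(1,2)
    by (auto simp: restrict_skeleton_def arcs_ends_def arc_to_ends_def)
  have vC: "verts C = {w. u \<rightarrow>\<^sup>*\<^bsub>?R\<^esub> w}" and
    aC: "arcs C = {e \<in> arcs ?R. tail ?R e \<in> {w. u \<rightarrow>\<^sup>*\<^bsub>?R\<^esub> w} \<and> head ?R e \<in> {w. u \<rightarrow>\<^sup>*\<^bsub>?R\<^esub> w}}"
    by (subst eq, simp)+
  show arcs: "arcs C = {e \<in> arcs G. \<alpha> e \<in> H \<and> tail G e \<in> verts C}"
    unfolding vC aC using step by (auto simp: restrict_skeleton_def)
  show "head G e \<in> verts C" if "e \<in> arcs C"
    using that step unfolding arcs vC by blast
qed

lemma morse_skeleton_component: "morse_skeleton C \<alpha> \<xi> \<phi>"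
proof
  note struct = component_structure
  show "finite (verts C)" "finite (arcs C)"
    using finite_subset[OF struct(1)] by (auto simp: struct(4))
  show "tail C e \<in> verts C" "head C e \<in> verts C" if "e \<in> arcs C" for e
    using that struct(5)[OF that] by (auto simp: struct(2,3,4))
  show "\<exists>e'\<in>arcs C. tail C e' = head C e \<and> head C e' = tail C e \<and> \<alpha> e' = - \<alpha> e" if "e \<in> arcs C" for e
  proof -
    have e: "e \<in> arcs G" "\<alpha> e \<in> H" "tail G e \<in> verts C" "head G e \<in> verts C"
      using that struct(5)[OF that] by (auto simp: struct(4))
    obtain e' where "e' \<in> arcs G" "tail G e' = head G e" "head G e' = tail G e" "\<alpha> e' = - \<alpha> e"
      using reverse_arc[OF e(1)] by blast
    with e H show ?thesis
      unfolding struct(2-4) by (intro bexI[of _ e']) (auto simp: subspace_neg)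
  qed
  show "\<alpha> e \<noteq> \<alpha> e' \<and> independent {\<alpha> e, \<alpha> e'}"
    if "e \<in> arcs C" "e' \<in> arcs C" "tail C e = tail C e'" "e \<noteq> e'" for e e'
    using that by (intro axial_independent) (auto simp: struct(2,4))
  show "\<alpha> e \<xi> \<noteq> 0" if "e \<in> arcs C" for e
    using that by (intro polarizing) (auto simp: struct(4))
  show "\<phi> (tail C e) < \<phi> (head C e)" if "e \<in> arcs C" "\<alpha> e \<xi> > 0" for e
    using that compatible by (auto simp: struct(2,3,4))
  show "inj_on \<phi> (verts C)"
    using inj struct(1) by (rule inj_on_subset)
qed

lemma descending_component:
  "v \<in> verts C \<Longrightarrow> morse_skeleton.descending C \<alpha> \<xi> v = {e \<in> descending v. \<alpha> e \<in> H}"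
  unfolding morse_skeleton.descending_def[OF morse_skeleton_component] descending_def
  by (auto simp: component_structure(2,4))

lemma axial_component: "\<alpha> ` arcs C \<subseteq> H"
  by (auto simp: component_structure(4))

lemma partial_class_component:
  "partial_class H' U f \<Longrightarrow> W \<subseteq> U \<Longrightarrow> morse_skeleton.partial_class C \<alpha> H' W f"
  unfolding morse_skeleton.partial_class_def[OF morse_skeleton_component] partial_class_def
  by (auto simp: component_structure(2-4))

text \<open>Restriction to a translate keeps the axial functions in \<open>H\<close> and makes the
  other descending ones at \<open>p\<close> nonzero at the origin; the homogeneous part then reduces
  their product to a constant.\<close>

lemma morse_family_component:
  assumes dim: "dim H = 2" and \<tau>: "morse_family UNIV \<tau>"
  shows "\<exists>\<sigma>. morse_skeleton.morse_family C \<alpha> \<xi> \<phi> H \<sigma>"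
proof -
  interpret C: morse_skeleton C \<alpha> \<xi> \<phi>
    by (rule morse_skeleton_component)
  note struct = component_structure
  obtain A where "A \<subseteq> H" "H \<subseteq> span A" "card A = 2"
    using basis_exists[of H] dim by metis
  then have A: "finite A" "span A = H"
    using span_minimal[OF _ H] by (auto intro: card_ge_0_finite)
  obtain \<pi> where \<pi>: "\<And>a x. a \<in> H \<Longrightarrow> blinfun_apply a (\<pi> x) = blinfun_apply a x"
    "\<And>b. \<exists>b'\<in>H. \<forall>x. blinfun_apply b (\<pi> x) = blinfun_apply b' x"
    using projection_onto_span[OF A(1)] A(2) by metis
  define K where "K = {y. \<forall>a\<in>H. blinfun_apply a y = 0}"
  have K: "subspace K"
    unfolding K_def subspace_def by (auto simp: blinfun.add_right blinfun.scaleR_right)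
  define transverse where "transverse p = {e \<in> descending p. \<alpha> e \<notin> H}" for p
  have fin: "finite (transverse p)" for p
    using finite_descending by (simp add: transverse_def)
  \<comment> \<open>If the product vanished on all of \<open>K\<close>, cancelling its factors would
    leave the constant 1 equal to 0.\<close>
  have nz: "\<exists>y\<in>K. (\<Prod>e\<in>transverse p. \<alpha> e y) \<noteq> 0" for p
  proof (rule ccontr)
    assume *: "\<not> ?thesis"
    have "(\<lambda>y. 1) 0 = (0::real)"
    proof (rule prod_linear_cancel[OF K, of "transverse p" \<alpha>])
      show "\<exists>y\<in>K. \<alpha> e y \<noteq> 0" if "e \<in> transverse p" for e
      proof (rule ccontr)
        assume zero: "\<not> ?thesis"
        obtain b' where b': "b' \<in> H" "\<And>x. \<alpha> e (\<pi> x) = blinfun_apply b' x"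
          using \<pi>(2) by blast
        \<comment> \<open>An axial function that is zero on \<open>K\<close> equals its pullback
          under \<pi>, hence lies in \<open>H\<close>.\<close>
        have "x - \<pi> x \<in> K" for x
          using \<pi>(1) by (simp add: K_def blinfun.diff_right)
        with zero have "\<alpha> e (x - \<pi> x) = 0" for x
          by blast
        then have "\<alpha> e x = blinfun_apply b' x" for x
          by (simp add: blinfun.diff_right b'(2))
        then have "\<alpha> e = b'"
          by (rule blinfun_eqI)
        with b' that show False
          by (simp add: transverse_def)
      qed
    qed (use * subspace_0[OF K] in auto)
    then show False by simp
  qed
  have "\<exists>\<sigma>. C.partial_class H (verts C) \<sigma> \<and> (\<forall>q\<in>C.below p. \<sigma> q = (\<lambda>x. 0)) \<and>
      \<sigma> p = (\<lambda>x. \<Prod>e\<in>C.descending p. \<alpha> e x)" if p: "p \<in> verts C" for p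
  proof -
    have pG: "p \<in> verts G"
      using p struct(1) by blast
    obtain y where y: "y \<in> K" "(\<Prod>e\<in>transverse p. \<alpha> e y) \<noteq> 0"
      using nz by blast
    define restr where "restr f = (\<lambda>x. f (\<pi> x + y))" for f :: "'g \<Rightarrow> real"
    have restr: "restr f \<in> sym_alg H" if "f \<in> sym_alg UNIV" for f
      unfolding restr_def
    proof (rule sym_alg_compose_affine[OF that])
      fix b :: "'g \<Rightarrow>\<^sub>L real"
      obtain b' where "b' \<in> H" "\<And>x. b (\<pi> x) = blinfun_apply b' x"
        using \<pi>(2) by blast
      then show "\<exists>b'\<in>H. \<exists>c. \<forall>x. blinfun_apply b (\<pi> x + y) = blinfun_apply b' x + c"
        by (auto simp: blinfun.add_right)
    qed
    have shift: "blinfun_apply a (\<pi> x + y) = blinfun_apply a x" if "a \<in> H" for a x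
      using that \<pi>(1) y by (simp add: K_def blinfun.add_right)
    define D where "D = C.descending p"
    have D: "D = {e \<in> descending p. \<alpha> e \<in> H}"
      unfolding D_def by (rule descending_component[OF p])
    define u where "u = restr (\<lambda>x. \<Prod>e\<in>transverse p. \<alpha> e x)"
    have u: "u \<in> sym_alg H"
      unfolding u_def by (intro restr sym_alg_prod sym_alg.linear UNIV_I)
    \<comment> \<open>Thus \<open>u 0\<close> is the transverse product at \<open>y\<close>, nonzero
      by the choice of \<open>y\<close>.\<close>
    have "\<alpha> e (\<pi> 0) = 0" for e
      using \<pi>(2)[of "\<alpha> e"] by auto
    then have u0: "u 0 \<noteq> 0"
      using y(2) by (simp add: u_def restr_def blinfun.add_right)
    define part where "part q = homogeneous_part (card D) (restr (\<tau> p q))" for q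
    define \<sigma> where "\<sigma> q = (\<lambda>x. part q x * (1 / u 0))" for q
    have \<tau>p: "partial_class UNIV (verts G) (\<tau> p)" "\<And>q. q \<in> below p \<Longrightarrow> \<tau> p q = (\<lambda>x. 0)"
      "\<tau> p p = (\<lambda>x. \<Prod>e\<in>descending p. \<alpha> e x)"
      using \<tau> pG by (auto simp: morse_family_def)
    have "C.partial_class H (verts C) \<sigma>"
      unfolding C.partial_class_def
    proof (intro conjI ballI impI allI)
      show "\<sigma> q \<in> sym_alg H" if "q \<in> verts C" for q
      proof -
        have "\<tau> p q \<in> sym_alg UNIV"
          using \<tau>p(1) that struct(1) by (auto simp: partial_class_def)
        then have "part q \<in> sym_alg H"
          unfolding part_def by (intro sym_alg_homogeneous_part restr)
        then show ?thesis
          unfolding \<sigma>_def by (rule sym_alg.mult[OF _ sym_alg.const])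
      qed
      fix e x assume e: "e \<in> arcs C" and x: "\<alpha> e x = 0"
      have eG: "e \<in> arcs G" "\<alpha> e \<in> H"
        using e by (auto simp: struct(4))
      \<comment> \<open>The kernel of \<open>\<alpha> e\<close> is closed under scaling, so the
        congruence holds along the whole ray through \<open>x\<close> and passes to homogeneous
        parts.\<close>
      have "\<tau> p (tail G e) (\<pi> (t *\<^sub>R x) + y) = \<tau> p (head G e) (\<pi> (t *\<^sub>R x) + y)" for t
        using eG x by (intro partial_class_eq_on_kernel[OF \<tau>p(1)])
          (simp_all add: shift blinfun.scaleR_right)
      then have "part (tail G e) x = part (head G e) x"
        unfolding part_def restr_def by (rule homogeneous_part_cong)
      then show "\<sigma> (tail C e) x = \<sigma> (head C e) x"
        by (simp add: \<sigma>_def struct(2,3))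
    qed
    moreover have "\<sigma> q = (\<lambda>x. 0)" if "q \<in> C.below p" for q
    proof -
      have "q \<in> below p"
        using that struct(1) by (auto simp: below_def C.below_def)
      then show ?thesis
        by (simp add: \<sigma>_def part_def restr_def \<tau>p(2))
    qed
    moreover have "\<sigma> p = (\<lambda>x. \<Prod>e\<in>D. \<alpha> e x)"
    proof
      fix x
      have D_shift: "(\<Prod>e\<in>D. \<alpha> e (\<pi> z + y)) = (\<Prod>e\<in>D. \<alpha> e z)" for z
        by (intro prod.cong refl shift) (simp add: D)
      have split: "descending p = D \<union> transverse p" "D \<inter> transverse p = {}" "finite D"
        using finite_descending by (auto simp: D transverse_def)
      have "restr (\<tau> p p) = (\<lambda>x. (\<Prod>e\<in>D. \<alpha> e x) * u x)"
        by (simp add: \<tau>p(3) restr_def u_def split(1) prod.union_disjoint[OF split(3) fin split(2)] D_shift)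
      then have "part p x = (\<Prod>e\<in>D. \<alpha> e x) * u 0"
        unfolding part_def by (simp only: homogeneous_part_prod_linear_mult[OF u])
      with u0 show "\<sigma> p x = (\<Prod>e\<in>D. \<alpha> e x)"
        by (simp add: \<sigma>_def)
    qed
    ultimately show ?thesis
      unfolding D_def by blast
  qed
  then show ?thesis
    unfolding C.morse_family_def by metis
qed

end

text \<open>Two descending edges at \<open>v\<close> span a plane \<open>H\<close>, and the
  component of \<open>v\<close> contains all descending edges at \<open>v\<close> with axial
  function in \<open>H\<close>. Its extendability is the local interpolation condition; the
  coefficients are \<open>UNIV\<close> because the prescribed values are arbitrary
  polynomials.\<close>

lemma extendable_if_components_extendable:
  assumes "\<And>H C. \<lbrakk>subspace H; dim H = 2; component_of C (restrict_skeleton G \<alpha> H)\<rbrakk> \<Longrightarrow>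
    morse_skeleton.extendable C \<alpha> \<xi> \<phi> UNIV"
  shows "extendable UNIV"
  unfolding extendable_def
proof (intro ballI allI impI)
  fix v f assume v: "v \<in> verts G" and f: "partial_class UNIV (below v) f"
  have desc: "e \<in> arcs G" "tail G e = v" "head G e \<in> below v" if "e \<in> descending v" for e
    using that descending_subset tail_descending head_descending by auto
  have "\<exists>g\<in>sym_alg UNIV. \<forall>e\<in>descending v. \<forall>x. \<alpha> e x = 0 \<longrightarrow> g x = f (head G e) x"
  proof (rule interpolation_local_in_codimension_two[OF finite_descending])
    show indep: "\<alpha> i \<noteq> \<alpha> j \<and> independent {\<alpha> i, \<alpha> j}"
      if "i \<in> descending v" "j \<in> descending v" "i \<noteq> j" for i j
      using that desc by (intro axial_independent) auto
    show "\<alpha> e \<noteq> 0" if "e \<in> descending v" for e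
      using that desc axial_nonzero by fastforce
    show "f (head G e) \<in> sym_alg UNIV" if "e \<in> descending v" for e
      using f desc(3)[OF that] by (simp add: partial_class_def)
    fix i j assume ij: "i \<in> descending v" "j \<in> descending v" "i \<noteq> j"
    define H where "H = span {\<alpha> i, \<alpha> j}"
    have H: "subspace H"
      by (simp add: H_def)
    have "dim H = card {\<alpha> i, \<alpha> j}"
      unfolding H_def using indep[OF ij] by (intro dim_span_eq_card_independent) blast
    then have dim: "dim H = 2"
      using indep[OF ij] by simp
    let ?R = "restrict_skeleton G \<alpha> H"
    interpret R: sym_digraph ?R
      by (rule sym_digraph_restrict_skeleton[OF H])
    define C where "C = ?R \<restriction> {w. v \<rightarrow>\<^sup>*\<^bsub>?R\<^esub> w}"
    have vR: "v \<in> verts ?R"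
      using v by (simp add: restrict_skeleton_def)
    have comp: "component_of C ?R"
      unfolding C_def by (rule R.component_of_reachable[OF vR])
    interpret C: morse_skeleton C \<alpha> \<xi> \<phi>
      by (rule morse_skeleton_component[OF H comp])
    note struct = component_structure[OF H comp]
    have vC: "v \<in> verts C"
      using vR by (simp add: C_def)
    have "C.partial_class UNIV (C.below v) f"
      using struct(1) by (intro partial_class_component[OF H comp f]) (auto simp: below_def C.below_def)
    with assms[OF H dim comp] vC obtain g where g: "g \<in> sym_alg UNIV"
      "\<forall>e\<in>C.descending v. \<forall>x. \<alpha> e x = 0 \<longrightarrow> g x = f (head C e) x"
      unfolding C.extendable_def by blast
    then show "\<exists>g\<in>sym_alg UNIV. \<forall>k\<in>descending v. \<alpha> k \<in> span {\<alpha> i, \<alpha> j} \<longrightarrow>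
        (\<forall>x. \<alpha> k x = 0 \<longrightarrow> g x = f (head G k) x)"
      by (intro bexI[of _ g]) (simp_all add: descending_component[OF H comp vC] struct(3) H_def)
  qed
  then show "\<exists>g\<in>sym_alg UNIV. \<forall>e\<in>descending v. \<forall>x. \<alpha> e x = 0 \<longrightarrow> g x = f (head G e) x" .
qed

end

section \<open>From one-skeleta to the equivalence\<close>

lemma (in one_skeleton) morse_skeleton:
  assumes "polarizing \<Gamma> \<alpha> \<xi>" "xi_compatible \<Gamma> \<alpha> \<xi> \<phi>" "inj_on \<phi> (verts \<Gamma>)"
  shows "morse_skeleton \<Gamma> \<alpha> \<xi> \<phi>"
proof
  show "\<exists>e'\<in>arcs \<Gamma>. tail \<Gamma> e' = head \<Gamma> e \<and> head \<Gamma> e' = tail \<Gamma> e \<and> \<alpha> e' = - \<alpha> e" if "e \<in> arcs \<Gamma>" for e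
    using that axial_bar by (intro bexI[of _ "bar e"]) auto
  show "\<alpha> e \<noteq> \<alpha> e' \<and> independent {\<alpha> e, \<alpha> e'}"
    if "e \<in> arcs \<Gamma>" "e' \<in> arcs \<Gamma>" "tail \<Gamma> e = tail \<Gamma> e'" "e \<noteq> e'" for e e'
    using that axial_independent[of "tail \<Gamma> e" e e'] by auto
qed (use assms in \<open>auto simp: polarizing_def xi_compatible_def\<close>)

theorem theorem2p2:
  fixes \<Gamma> :: "('v, 'e) pre_digraph"
    and bar :: "'e \<Rightarrow> 'e"
    and d :: nat
    and \<alpha> :: "'e \<Rightarrow> ('g::euclidean_space \<Rightarrow>\<^sub>L real)"
    and \<xi> :: 'g
    and \<phi> :: "'v \<Rightarrow> real"
  assumes "DIM('g) > 1"
    and "one_skeleton \<Gamma> bar d \<alpha>"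
    and "polarizing \<Gamma> \<alpha> \<xi>"
    and "generic \<Gamma> \<alpha> \<xi>"
    and "xi_acyclic \<Gamma> \<alpha> \<xi>"
    and "xi_compatible \<Gamma> \<alpha> \<xi> \<phi>"
    and "inj_on \<phi> (verts \<Gamma>)"
  shows "admits_generating_family \<Gamma> \<alpha> UNIV \<xi> \<longleftrightarrow>
    (\<forall>H. subspace H \<and> dim H = 2 \<longrightarrow>
      (\<forall>C. component_of C (restrict_skeleton \<Gamma> \<alpha> H) \<longrightarrow> admits_generating_family C \<alpha> H \<xi>))"
proof -
  interpret morse_skeleton \<Gamma> \<alpha> \<xi> \<phi>
    using assms by (intro one_skeleton.morse_skeleton)
  show ?thesis
  proof (intro iffI allI impI; (elim conjE)?)
    fix H C
    assume "admits_generating_family \<Gamma> \<alpha> UNIV \<xi>" and H: "subspace H" "dim H = 2"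
      and C: "component_of C (restrict_skeleton \<Gamma> \<alpha> H)"
    then obtain \<tau> where "morse_family UNIV \<tau>"
      using generating_family_imp_morse_family[of UNIV] by auto
    then obtain \<sigma> where \<sigma>: "morse_skeleton.morse_family C \<alpha> \<xi> \<phi> H \<sigma>"
      using morse_family_component[OF H(1) C H(2)] by blast
    interpret C: morse_skeleton C \<alpha> \<xi> \<phi>
      by (rule morse_skeleton_component[OF H(1) C])
    note ax = axial_component[OF H(1) C]
    \<comment> \<open>The classes in \<sigma> are only known to vanish on sublevel sets; rebuilding
      them through extendability gives vanishing outside the flow-ups of \<open>C\<close>.\<close>
    show "admits_generating_family C \<alpha> H \<xi>"
      using C.extendable_imp_generating_family[OF H(1) ax]
        C.morse_family_imp_extendable[OF H(1) ax \<sigma>] .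
  next
    assume fam: "\<forall>H. subspace H \<and> dim H = 2 \<longrightarrow>
      (\<forall>C. component_of C (restrict_skeleton \<Gamma> \<alpha> H) \<longrightarrow> admits_generating_family C \<alpha> H \<xi>)"
    have "extendable UNIV"
    proof (rule extendable_if_components_extendable)
      fix H C assume H: "subspace H" "dim H = 2" and C: "component_of C (restrict_skeleton \<Gamma> \<alpha> H)"
      interpret C: morse_skeleton C \<alpha> \<xi> \<phi>
        by (rule morse_skeleton_component[OF H(1) C])
      obtain \<tau> where "C.morse_family H \<tau>"
        using C.generating_family_imp_morse_family[OF H(1) axial_component[OF H(1) C]] fam H C by blast
      \<comment> \<open>The same classes serve over the larger coefficient ring, where the partial
        classes of the whole graph take their values.\<close>
      then have "C.morse_family UNIV \<tau>"
        by (rule C.morse_family_mono) simp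
      then show "C.extendable UNIV"
        by (intro C.morse_family_imp_extendable) auto
    qed
    then show "admits_generating_family \<Gamma> \<alpha> UNIV \<xi>"
      by (intro extendable_imp_generating_family) auto
  qed
qed

end
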